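(* Let $1\le p<\infty$ and let $\mu$ be a positive Borel measure on $\mathbb{D}$ satisfying the standing axiom on $D^p_\mu$ stated in the context. Assume that the Banach space $M_0(D^p_\mu)$ is separable. Let $\varphi$ be an analytic self-map of $\mathbb{D}$. Then the following statements are equivalent: (a) $C_\varphi:\mathcal{B}\to M_0(D^p_\mu)$ is a bounded operator. (b) $C_\varphi:\mathcal{B}\to M_0(D^p_\mu)$ is a compact operator. (c) Both conditions $$\lim_{|\sigma(0)|\to1,\ \sigma\in Aut(\mathbb{D})}\int_{\mathbb{D}}|(\varphi\circ\sigma)^{\#}|^p\,d\mu=0\quad\text{and}\quad\sup_{\sigma\in Aut(\mathbb{D})}\int_{\mathbb{D}}|(\varphi\circ\sigma)^{\#}|^p\,d\mu<\infty$$ are fulfilled.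
   Context: $\mathbb{D}=\{z\in\mathbb{C}:|z|<1\}$; $\mathcal{H}(\mathbb{D})$ is the set of analytic functions on $\mathbb{D}$; $Aut(\mathbb{D})$ is the group of disk automorphisms, i.e. one-to-one analytic maps of $\mathbb{D}$ onto itself. A self-map of $\mathbb{D}$ is an analytic function $\varphi:\mathbb{D}\to\mathbb{D}$, and $C_\varphi(f)=f\circ\varphi$ for $f\in\mathcal{H}(\mathbb{D})$. For a self-map $\varphi$, the hyperbolic derivative is $\varphi^{\#}(z)=\frac{|\varphi'(z)|}{1-|\varphi(z)|^2}$. The Bloch space $\mathcal{B}$ is the Banach space of all $f\in\mathcal{H}(\mathbb{D})$ with $\|f\|_{\mathcal{B}}=|f(0)|+\sup_{z\in\mathbb{D}}(1-|z|^2)|f'(z)|<\infty$. For a positive Borel measure $\mu$ on $\mathbb{D}$ and $1\le p<\infty$, $D^p_\mu$ is the space of all $f\in\mathcal{H}(\mathbb{D})$ with $\|f\|_{D^p_\mu}^p=|f(0)|^p+\int_{\mathbb{D}}|f'|^p\,d\mu<\infty$. Standing axiom: $D^p_\mu$ is a Banach space and the point-evaluation functionals $f\mapsto f(\zeta)$ are uniformly bounded on $D^p_\mu$ for $\zeta$ in compact subsets of $\mathbb{D}$ (for each compact $K\subset\mathbb{D}$ there is $C_K$ with $|f(\zeta)|\le C_K\|f\|_{D^p_\mu}$ for all $\zeta\in K$, $f\in D^p_\mu$). $M(D^p_\mu)$ is the space of all $f\in\mathcal{H}(\mathbb{D})$ with $\|f\|_{M(D^p_\mu)}^p=|f(0)|^p+\sup_{\sigma\in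 Aut(\mathbb{D})}\int_{\mathbb{D}}|(f\circ\sigma)'|^p\,d\mu<\infty$. The little space, normed as a subspace of $M(D^p_\mu)$, is $$M_0(D^p_\mu)=\Big\{f\in M(D^p_\mu):\ \lim_{|\sigma(0)|\to1,\ \sigma\in Aut(\mathbb{D})}\int_{\mathbb{D}}|(f\circ\sigma)'|^p\,d\mu=0\Big\}.$$ *)

theory Defs
  imports "HOL-Analysis.Analysis"
begin

text \<open>
  The spaces involved depend on a measure and an exponent, so they are given by a carrier set
  \<open>V\<close> of functions together with a norm \<open>N\<close>. The distance is cut off to \<open>0\<close> outside \<open>V\<close> because
  \<^locale>\<open>Metric_space\<close> demands symmetry and nonnegativity on the whole type.
\<close>

definition normed_fun_space :: "(complex \<Rightarrow> complex) set \<Rightarrow> ((complex \<Rightarrow> complex) \<Rightarrow> real) \<Rightarrow> bool"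
  where "normed_fun_space V N \<longleftrightarrow>
    (\<lambda>_. 0) \<in> V \<and>
    (\<forall>f\<in>V. \<forall>g\<in>V. (\<lambda>z. f z + g z) \<in> V \<and> N (\<lambda>z. f z + g z) \<le> N f + N g) \<and>
    (\<forall>c. \<forall>f\<in>V. (\<lambda>z. c * f z) \<in> V \<and> N (\<lambda>z. c * f z) = cmod c * N f) \<and>
    (\<forall>f\<in>V. N f \<ge> 0 \<and> (N f = 0 \<longrightarrow> f = (\<lambda>_. 0)))"

definition fun_dist ::
  "(complex \<Rightarrow> complex) set \<Rightarrow> ((complex \<Rightarrow> complex) \<Rightarrow> real) \<Rightarrow>
    (complex \<Rightarrow> complex) \<Rightarrow> (complex \<Rightarrow> complex) \<Rightarrow> real"
  where "fun_dist V N f g = (if f \<in> V \<and> g \<in> V then N (\<lambda>z. f z - g z) else 0)"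

lemma normed_fun_spaceD:
  assumes "normed_fun_space V N" "f \<in> V"
  shows "g \<in> V \<Longrightarrow> (\<lambda>z. f z + g z) \<in> V"
    and "g \<in> V \<Longrightarrow> N (\<lambda>z. f z + g z) \<le> N f + N g"
    and "(\<lambda>z. c * f z) \<in> V"
    and "N (\<lambda>z. c * f z) = cmod c * N f"
    and "N f \<ge> 0"
    and "N f = 0 \<Longrightarrow> f = (\<lambda>_. 0)"
  using assms unfolding normed_fun_space_def by simp_all

lemma normed_fun_space_diff:
  assumes "normed_fun_space V N" "f \<in> V" "g \<in> V"
  shows "(\<lambda>z. f z - g z) \<in> V"
  using normed_fun_spaceD(1)[OF assms(1,2) normed_fun_spaceD(3)[OF assms(1,3), of "- 1"]] by simp

lemma normed_fun_space_diff_commute: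
  assumes "normed_fun_space V N" "f \<in> V" "g \<in> V"
  shows "N (\<lambda>z. f z - g z) = N (\<lambda>z. g z - f z)"
  using normed_fun_spaceD(4)[OF assms(1) normed_fun_space_diff[OF assms(1,3,2)], of "- 1"] by simp

lemma Metric_space_fun_dist:
  assumes V: "normed_fun_space V N"
  shows "Metric_space V (fun_dist V N)"
proof
  fix f g
  show "0 \<le> fun_dist V N f g"
    using normed_fun_spaceD(5)[OF V, where f = "\<lambda>z. f z - g z"] normed_fun_space_diff[OF V]
    by (simp add: fun_dist_def)
  show "fun_dist V N f g = fun_dist V N g f"
    using normed_fun_space_diff_commute[OF V, of f g] by (auto simp: fun_dist_def)
next
  fix f g assume fg: "f \<in> V" "g \<in> V"
  have N0: "N (\<lambda>_. 0) = 0"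
    using normed_fun_spaceD(4)[OF V fg(1), of 0] by simp
  have "f = g" if "N (\<lambda>z. f z - g z) = 0"
  proof -
    have "(\<lambda>z. f z - g z) = (\<lambda>_. 0)"
      using normed_fun_spaceD(6)[where f = "\<lambda>z. f z - g z"] V normed_fun_space_diff[OF V fg] that
      by simp
    then have "f z - g z = 0" for z by meson
    then show ?thesis by (intro ext) simp
  qed
  then show "(fun_dist V N f g = 0) = (f = g)"
    using fg N0 by (auto simp: fun_dist_def)
next
  fix f g h assume fgh: "f \<in> V" "g \<in> V" "h \<in> V"
  have "N (\<lambda>z. f z - h z) \<le> N (\<lambda>z. f z - g z) + N (\<lambda>z. g z - h z)"
    using normed_fun_spaceD(2)[OF V, where f = "\<lambda>z. f z - g z" and g = "\<lambda>z. g z - h z"]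
      normed_fun_space_diff[OF V] fgh by simp
  then show "fun_dist V N f h \<le> fun_dist V N f g + fun_dist V N g h"
    using fgh by (simp add: fun_dist_def)
qed

definition banach_fun_space :: "(complex \<Rightarrow> complex) set \<Rightarrow> ((complex \<Rightarrow> complex) \<Rightarrow> real) \<Rightarrow> bool"
  where "banach_fun_space V N \<longleftrightarrow>
    normed_fun_space V N \<and> Metric_space.mcomplete V (fun_dist V N)"

abbreviation norm_topology ::
  "(complex \<Rightarrow> complex) set \<Rightarrow> ((complex \<Rightarrow> complex) \<Rightarrow> real) \<Rightarrow> (complex \<Rightarrow> complex) topology"
  where "norm_topology V N \<equiv> Metric_space.mtopology V (fun_dist V N)"

definition linear_operator ::
  "(complex \<Rightarrow> complex) set \<Rightarrow> (complex \<Rightarrow> complex) set \<Rightarrow>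
    ((complex \<Rightarrow> complex) \<Rightarrow> complex \<Rightarrow> complex) \<Rightarrow> bool"
  where "linear_operator V W T \<longleftrightarrow>
    T ` V \<subseteq> W \<and>
    (\<forall>f\<in>V. \<forall>g\<in>V. T (\<lambda>z. f z + g z) = (\<lambda>z. T f z + T g z)) \<and>
    (\<forall>c. \<forall>f\<in>V. T (\<lambda>z. c * f z) = (\<lambda>z. c * T f z))"

definition bounded_operator ::
  "(complex \<Rightarrow> complex) set \<Rightarrow> ((complex \<Rightarrow> complex) \<Rightarrow> real) \<Rightarrow>
    (complex \<Rightarrow> complex) set \<Rightarrow> ((complex \<Rightarrow> complex) \<Rightarrow> real) \<Rightarrow>
    ((complex \<Rightarrow> complex) \<Rightarrow> complex \<Rightarrow> complex) \<Rightarrow> bool"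
  where "bounded_operator V N W N' T \<longleftrightarrow>
    linear_operator V W T \<and> (\<exists>C. \<forall>f\<in>V. N' (T f) \<le> C * N f)"

definition compact_operator ::
  "(complex \<Rightarrow> complex) set \<Rightarrow> ((complex \<Rightarrow> complex) \<Rightarrow> real) \<Rightarrow>
    (complex \<Rightarrow> complex) set \<Rightarrow> ((complex \<Rightarrow> complex) \<Rightarrow> real) \<Rightarrow>
    ((complex \<Rightarrow> complex) \<Rightarrow> complex \<Rightarrow> complex) \<Rightarrow> bool"
  where "compact_operator V N W N' T \<longleftrightarrow>
    linear_operator V W T \<and>
    compactin (norm_topology W N') (norm_topology W N' closure_of (T ` {f \<in> V. N f \<le> 1}))"

abbreviation disk :: "complex set"
  where "disk \<equiv> ball 0 1"

text \<open>
  A function on the disk is represented by its extension by \<open>0\<close>, so that equality of elements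
  of \<open>H_disk\<close> is equality on the disk (and norms can be definite).
\<close>

definition H_disk :: "(complex \<Rightarrow> complex) set"
  where "H_disk = {f. f holomorphic_on disk \<and> (\<forall>z. z \<notin> disk \<longrightarrow> f z = 0)}"

definition Aut_disk :: "(complex \<Rightarrow> complex) set"
  where "Aut_disk = {\<sigma>. \<sigma> holomorphic_on disk \<and> bij_betw \<sigma> disk disk}"

definition self_map :: "(complex \<Rightarrow> complex) \<Rightarrow> bool"
  where "self_map \<phi> \<longleftrightarrow> \<phi> holomorphic_on disk \<and> \<phi> ` disk \<subseteq> disk"

definition comp_op :: "(complex \<Rightarrow> complex) \<Rightarrow> (complex \<Rightarrow> complex) \<Rightarrow> complex \<Rightarrow> complex"
  where "comp_op \<phi> f = (\<lambda>z. if z \<in> disk then f (\<phi> z) else 0)"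

definition hyp_deriv :: "(complex \<Rightarrow> complex) \<Rightarrow> complex \<Rightarrow> real"
  where "hyp_deriv \<phi> z = cmod (deriv \<phi> z) / (1 - (cmod (\<phi> z))\<^sup>2)"

text \<open>The filter describing \<open>\<bar>\<sigma>(0)\<bar> \<rightarrow> 1\<close> with \<open>\<sigma>\<close> ranging over the automorphisms.\<close>

definition aut_boundary :: "(complex \<Rightarrow> complex) filter"
  where "aut_boundary = inf (filtercomap (\<lambda>\<sigma>. cmod (\<sigma> 0)) (at_left 1)) (principal Aut_disk)"

lemma eventually_aut_boundary:
  "eventually P aut_boundary \<longleftrightarrow> (\<exists>r<1. \<forall>\<sigma>\<in>Aut_disk. r < cmod (\<sigma> 0) \<longrightarrow> P \<sigma>)"
proof -
  have less_1: "cmod (\<sigma> 0) < 1" if "\<sigma> \<in> Aut_disk" for \<sigma>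
    using that bij_betwE[of \<sigma> disk disk] by (force simp: Aut_disk_def)
  show ?thesis
    unfolding aut_boundary_def eventually_inf_principal eventually_filtercomap
      eventually_at_left_field
  proof safe
    fix b :: real and Q
    assume "b < 1" and Q: "\<forall>y>b. y < 1 \<longrightarrow> Q y"
      and P: "\<forall>\<sigma>. Q (cmod (\<sigma> 0)) \<longrightarrow> \<sigma> \<in> Aut_disk \<longrightarrow> P \<sigma>"
    then have "\<forall>\<sigma>\<in>Aut_disk. b < cmod (\<sigma> 0) \<longrightarrow> P \<sigma>"
      using less_1 by simp
    with \<open>b < 1\<close> show "\<exists>r<1. \<forall>\<sigma>\<in>Aut_disk. r < cmod (\<sigma> 0) \<longrightarrow> P \<sigma>"
      by (intro exI[of _ b] conjI)
  next
    fix r :: real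
    assume "r < 1" and P: "\<forall>\<sigma>\<in>Aut_disk. r < cmod (\<sigma> 0) \<longrightarrow> P \<sigma>"
    then show "\<exists>Q. (\<exists>b<1. \<forall>y>b. y < 1 \<longrightarrow> Q y) \<and> (\<forall>\<sigma>. Q (cmod (\<sigma> 0)) \<longrightarrow> \<sigma> \<in> Aut_disk \<longrightarrow> P \<sigma>)"
      by (intro exI[of _ "\<lambda>y. r < y"] conjI exI[of _ r]) auto
  qed
qed

definition Bloch :: "(complex \<Rightarrow> complex) set"
  where "Bloch = {f \<in> H_disk. bdd_above ((\<lambda>z. (1 - (cmod z)\<^sup>2) * cmod (deriv f z)) ` disk)}"

definition Bloch_norm :: "(complex \<Rightarrow> complex) \<Rightarrow> real"
  where "Bloch_norm f = cmod (f 0) + (SUP z\<in>disk. (1 - (cmod z)\<^sup>2) * cmod (deriv f z))"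

definition deriv_integral :: "complex measure \<Rightarrow> real \<Rightarrow> (complex \<Rightarrow> complex) \<Rightarrow> ennreal"
  where "deriv_integral \<mu> p f = (\<integral>\<^sup>+ z. ennreal (cmod (deriv f z) powr p) \<partial>\<mu>)"

definition hyp_integral :: "complex measure \<Rightarrow> real \<Rightarrow> (complex \<Rightarrow> complex) \<Rightarrow> ennreal"
  where "hyp_integral \<mu> p \<phi> = (\<integral>\<^sup>+ z. ennreal (hyp_deriv \<phi> z powr p) \<partial>\<mu>)"

definition D_space :: "complex measure \<Rightarrow> real \<Rightarrow> (complex \<Rightarrow> complex) set"
  where "D_space \<mu> p = {f \<in> H_disk. deriv_integral \<mu> p f < \<infinity>}"

definition D_norm :: "complex measure \<Rightarrow> real \<Rightarrow> (complex \<Rightarrow> complex) \<Rightarrow> real"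
  where "D_norm \<mu> p f = (cmod (f 0) powr p + enn2real (deriv_integral \<mu> p f)) powr (1 / p)"

definition M_space :: "complex measure \<Rightarrow> real \<Rightarrow> (complex \<Rightarrow> complex) set"
  where "M_space \<mu> p = {f \<in> H_disk. (SUP \<sigma>\<in>Aut_disk. deriv_integral \<mu> p (f \<circ> \<sigma>)) < \<infinity>}"

definition M_norm :: "complex measure \<Rightarrow> real \<Rightarrow> (complex \<Rightarrow> complex) \<Rightarrow> real"
  where "M_norm \<mu> p f =
    (cmod (f 0) powr p + enn2real (SUP \<sigma>\<in>Aut_disk. deriv_integral \<mu> p (f \<circ> \<sigma>))) powr (1 / p)"

definition M0_space :: "complex measure \<Rightarrow> real \<Rightarrow> (complex \<Rightarrow> complex) set"
  where "M0_space \<mu> p =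
    {f \<in> M_space \<mu> p. ((\<lambda>\<sigma>. deriv_integral \<mu> p (f \<circ> \<sigma>)) \<longlongrightarrow> 0) aut_boundary}"

definition standing_axiom :: "complex measure \<Rightarrow> real \<Rightarrow> bool"
  where "standing_axiom \<mu> p \<longleftrightarrow>
    banach_fun_space (D_space \<mu> p) (D_norm \<mu> p) \<and>
    (\<forall>K. compact K \<and> K \<subseteq> disk \<longrightarrow>
      (\<exists>C. \<forall>f\<in>D_space \<mu> p. \<forall>\<zeta>\<in>K. cmod (f \<zeta>) \<le> C * D_norm \<mu> p f))"

end

theory Submission
  imports Defs "HOL-Complex_Analysis.Complex_Analysis"
begin

text \<open>
  The lacunary series \<open>\<Sum>n. d\<^sub>n z^(100^n)\<close> with \<open>\<bar>d\<^sub>n\<bar> \<le> 1\<close> lie in \<open>Bloch\<close>. If the nonzero \<open>d\<^sub>n\<close> have indices of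
  one parity and \<open>\<bar>d\<^sub>m\<bar> = 1\<close>, then the \<open>m\<close>-th term dominates the derivative on the annulus
  \<open>1 - 100^(-m) \<le> \<bar>w\<bar> < 1 - 100^(-m-1)\<close>, and the derivative there is at least
  \<open>1 / (400 (1 - \<bar>w\<bar>\<^sup>2))\<close>. The two series with all coefficients of one parity equal to \<open>1\<close> therefore
  show that the hyperbolic conditions hold as soon as \<open>comp_op \<phi>\<close> maps \<open>Bloch\<close> into \<open>M0_space\<close>.

  Compactness needs the hyperbolic integral over \<open>{z. \<bar>\<phi> (\<sigma> z)\<bar> > R}\<close> to tend to \<open>0\<close> as \<open>R \<rightarrow> 1\<close> uniformly
  in \<open>\<sigma>\<close>; with Montel's theorem it then follows by splitting the integrals. Without the uniformity there
  are infinitely many disjoint blocks of annuli, each carrying a fixed mass for some automorphism, and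
  the lacunary series indexed by sets of blocks have images at a fixed mutual distance, which
  contradicts separability.
\<close>

section \<open>Lacunary series\<close>

text \<open>Powers of \<open>r\<close> decrease, so \<open>r ^ (100 ^ Suc N - 1)\<close> is at most
  each of the \<open>99 * 100 ^ N\<close> powers of \<open>r\<close> with exponent in the block from
  \<open>100 ^ N\<close> to \<open>100 ^ Suc N - 1\<close>. The factor 2 exceeds 100/99, and the
  blocks join to a geometric series.\<close>

lemma lacunary_sum_le:
  fixes r :: real
  assumes "0 \<le> r" "r < 1"
  shows "(\<Sum>n<N. 100 ^ n * r ^ (100 ^ n - 1)) \<le> 2 / (1 - r)"
proof -
  have "(\<Sum>n<Suc N. 100 ^ n * r ^ (100 ^ n - 1)) \<le> 2 * (\<Sum>k<100 ^ N. r ^ k)"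
  proof (induction N)
    case 0
    then show ?case by simp
  next
    case (Suc N)
    have "100 ^ Suc N * r ^ (100 ^ Suc N - 1) \<le> 2 * (99 * 100 ^ N * r ^ (100 ^ Suc N - 1))"
      using assms by simp
    also have "99 * 100 ^ N * r ^ (100 ^ Suc N - 1) = (\<Sum>k\<in>{100 ^ N..<100 ^ Suc N::nat}. r ^ (100 ^ Suc N - 1))"
      by (simp add: of_nat_diff)
    also have "\<dots> \<le> (\<Sum>k\<in>{100 ^ N..<100 ^ Suc N::nat}. r ^ k)"
      using assms by (intro sum_mono power_decreasing) auto
    finally have "100 ^ Suc N * r ^ (100 ^ Suc N - 1) \<le> 2 * (\<Sum>k\<in>{100 ^ N..<100 ^ Suc N::nat}. r ^ k)"
      by simp
    moreover have "(\<Sum>k<100 ^ Suc N. r ^ k) = (\<Sum>k<100 ^ N. r ^ k) + (\<Sum>k\<in>{100 ^ N..<100 ^ Suc N::nat}. r ^ k)"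
      using sum.atLeastLessThan_concat[of 0 "100 ^ N" "100 ^ Suc N" "\<lambda>k. r ^ k"]
      by (simp add: atLeast0LessThan)
    ultimately show ?case using Suc.IH by simp
  qed
  also have "(\<Sum>k<100 ^ N. r ^ k) \<le> 1 / (1 - r)"
    using assms by (simp add: sum_gp_strict divide_right_mono)
  finally have "(\<Sum>n<Suc N. 100 ^ n * r ^ (100 ^ n - 1)) \<le> 2 / (1 - r)" by simp
  moreover have "(\<Sum>n<N. 100 ^ n * r ^ (100 ^ n - 1)) \<le> (\<Sum>n<Suc N. 100 ^ n * r ^ (100 ^ n - 1))"
    using assms by simp
  ultimately show ?thesis by linarith
qed

text \<open>At \<open>r = 1 - 1 / K\<close> with \<open>K = 100 ^ m\<close> the power is
  \<open>(1 - 1 / K) ^ (K - 1)\<close>, which is at least 1/e and hence at least 1/3.\<close>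

lemma lacunary_term_lower:
  fixes r :: real
  assumes "1 - 1 / 100 ^ m \<le> r"
  shows "100 ^ m / 3 \<le> 100 ^ m * r ^ (100 ^ m - 1)"
proof (cases "m = 0")
  case False
  define K :: real where "K = 100 ^ m"
  have K: "K \<ge> 100"
    unfolding K_def using False self_le_power[of "100::real" m] by simp
  have "1 / r \<le> 1 + 1 / (K - 1)"
  proof -
    have "0 < (K - 1) / K" "(K - 1) / K \<le> r"
      using assms K by (simp_all add: K_def[symmetric] field_simps)
    then have "1 / r \<le> 1 / ((K - 1) / K)" by (intro divide_left_mono mult_pos_pos) auto
    also have "\<dots> = 1 + 1 / (K - 1)" using K by (simp add: field_simps)
    finally show ?thesis .
  qed
  also have "\<dots> \<le> exp (1 / (K - 1))" by (rule exp_ge_add_one_self)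
  finally have r1: "1 / r \<le> exp (1 / (K - 1))" .
  have "1 / K < 1" using K by simp
  then have r0: "0 < r" using assms by (simp add: K_def[symmetric])
  have "(1 / r) ^ (100 ^ m - 1) \<le> exp (1 / (K - 1)) ^ (100 ^ m - 1)"
    using r0 r1 by (intro power_mono) auto
  also have "\<dots> = exp (real (100 ^ m - 1) * (1 / (K - 1)))"
    by (rule exp_of_nat_mult[symmetric])
  also have "real (100 ^ m - 1) = K - 1" by (simp add: K_def of_nat_diff)
  also have "(K - 1) * (1 / (K - 1)) = 1" using K by simp
  finally have "(1 / r) ^ (100 ^ m - 1) \<le> 3" using exp_le by simp
  then have "1 / 3 \<le> r ^ (100 ^ m - 1)"
    using r0 by (simp add: power_divide field_simps)
  then show ?thesis by simp
qed simp

text \<open>Since \<open>r <= exp (- 1 / 100 ^ Suc m)\<close> and the exponent is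
  \<open>100 ^ (m + 2 + j) - 1\<close>, the power is at most \<open>exp (- 96 * 100 ^ j)\<close>.
  This absorbs the coefficient and leaves a geometric bound in \<open>j\<close>.\<close>

lemma lacunary_term_upper:
  fixes r :: real
  assumes "0 \<le> r" "r \<le> 1 - 1 / 100 ^ Suc m"
  shows "100 ^ (m + 2 + j) * r ^ (100 ^ (m + 2 + j) - 1) \<le> 100 ^ m / 33 * (1 / 100) ^ j"
proof -
  define N :: nat where "N = 100 ^ (m + 2 + j) - 1"
  define y :: real where "y = 100 ^ j"
  have y: "1 \<le> y" by (simp add: y_def)
  have "r \<le> exp (- (1 / 100 ^ Suc m))"
    using assms(2) exp_ge_add_one_self[of "- (1 / 100 ^ Suc m)"] by simp
  then have "r ^ N \<le> exp (- (1 / 100 ^ Suc m)) ^ N"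
    using assms by (intro power_mono) auto
  also have "\<dots> = exp (real N * (- (1 / 100 ^ Suc m)))"
    by (rule exp_of_nat_mult[symmetric])
  also have "real N * (- (1 / 100 ^ Suc m)) \<le> - (96 * y)"
  proof -
    have "real N = 100 ^ (m + 2 + j) - 1" by (simp add: N_def of_nat_diff)
    also have "\<dots> = 100 ^ Suc m * (100 * y) - 1" by (simp add: y_def power_add)
    finally have "real N / 100 ^ Suc m = 100 * y - 1 / 100 ^ Suc m"
      by (simp add: field_simps)
    moreover have "1 / 100 ^ Suc m \<le> (1::real)" using one_le_power[of "100::real" "Suc m"] by (simp only: divide_le_eq_1) simp
    ultimately show ?thesis using y by (simp only: mult_minus_right times_divide_eq_right mult_1_right)
  qed
  finally have rN: "r ^ N \<le> exp (- (96 * y))" by simp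
  \<comment> \<open>A fourth power replaces the exponential. The 96 is 4 * 24 and stays below the
    available 99; \<open>24 ^ 4 = 331776\<close> exceeds \<open>33 * 10000\<close>, which is where
    the 33 comes from.\<close>
  have "(24 * y) ^ 4 \<le> exp (24 * y) ^ 4"
    using y exp_ge_add_one_self[of "24 * y"] by (intro power_mono) linarith+
  also have "\<dots> = exp (96 * y)" using exp_of_nat_mult[of 4 "24 * y"] by simp
  finally have "exp (- (96 * y)) \<le> 1 / (24 * y) ^ 4"
    using y by (simp add: exp_minus field_simps)
  with rN have "r ^ N \<le> 1 / (24 * y) ^ 4" by linarith
  then have "100 ^ (m + 2 + j) * r ^ N \<le> 100 ^ (m + 2 + j) * (1 / (24 * y) ^ 4)"
    by (intro mult_left_mono) auto
  also have "\<dots> = 100 ^ m * (10000 * y / (331776 * y ^ 4))"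
    by (simp add: y_def power_add power_mult_distrib)
  also have "\<dots> \<le> 100 ^ m * (1 / 33 * (1 / y))"
  proof (rule mult_left_mono)
    have "10000 * 33 * y^2 \<le> 331776 * y ^ 4"
      using y by (intro mult_mono power_increasing) auto
    then show "10000 * y / (331776 * y ^ 4) \<le> 1 / 33 * (1 / y)"
      using y by (simp add: field_simps power2_eq_square)
  qed simp
  finally show ?thesis by (simp add: N_def y_def power_divide)
qed

text \<open>The cut-off to 0 outside the disk fits the encoding of \<open>H_disk\<close>.\<close>

definition lacunary :: "(nat \<Rightarrow> complex) \<Rightarrow> complex \<Rightarrow> complex"
  where "lacunary d z = (if z \<in> disk then (\<Sum>n. d n * z ^ (100 ^ n)) else 0)"

lemma lacunary_sums:
  assumes d: "\<And>n. cmod (d n) \<le> 1" and z: "z \<in> disk"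
  shows "(\<lambda>n. d n * z ^ (100 ^ n)) sums lacunary d z"
    and "(\<lambda>n. d n * (100 ^ n * z ^ (100 ^ n - 1))) sums deriv (lacunary d) z"
    and "lacunary d field_differentiable at z"
proof -
  have "\<exists>g g'. \<forall>x\<in>disk. ((\<lambda>n. d n * x ^ (100 ^ n)) sums g x) \<and>
      ((\<lambda>n. d n * (100 ^ n * x ^ (100 ^ n - 1))) sums g' x) \<and> (g has_field_derivative g' x) (at x)"
  proof (rule series_and_derivative_comparison_local)
    fix n and x :: complex
    show "((\<lambda>x. d n * x ^ (100 ^ n)) has_field_derivative d n * (100 ^ n * x ^ (100 ^ n - 1))) (at x)"
      by (auto intro!: derivative_eq_intros)
  next
    fix x :: complex assume "x \<in> disk"
    \<comment> \<open>With \<open>R\<close> halfway between \<open>cmod x\<close> and 1, the ball of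
      radius \<open>R - cmod x\<close> around \<open>x\<close> lies in the disk of radius
      \<open>R\<close>, where \<open>R ^ n\<close> is a summable majorant.\<close>
    define R where "R = (1 + cmod x) / 2"
    have R: "0 \<le> R" "R < 1" "cmod x < R" using \<open>x \<in> disk\<close> by (auto simp: R_def)
    have "norm (d n * y ^ 100 ^ n) \<le> R ^ n" if "y \<in> ball x (R - cmod x) \<inter> disk" for y n
    proof -
      have "cmod y \<le> cmod x + dist x y" by (metis dist_0_norm dist_triangle)
      then have y: "cmod y \<le> R" using that by auto
      have "norm (d n * y ^ 100 ^ n) \<le> cmod y ^ 100 ^ n"
        using d[of n] by (simp add: norm_mult norm_power mult_left_le_one_le)
      also have "\<dots> \<le> R ^ 100 ^ n" using y by (intro power_mono) auto
      also have "\<dots> \<le> R ^ n" using R by (intro power_decreasing less_imp_le[OF power_gt_expt]) auto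
      finally show ?thesis .
    qed
    then show "\<exists>da h. 0 < da \<and> summable h \<and> (\<forall>\<^sub>F n in sequentially. \<forall>y\<in>ball x da \<inter> disk. norm (d n * y ^ 100 ^ n) \<le> h n)"
      using R by (intro exI[of _ "R - cmod x"] exI[of _ "\<lambda>n. R ^ n"]) (auto intro!: summable_geometric)
  qed simp
  then obtain g g' where g: "\<And>x. x \<in> disk \<Longrightarrow> (\<lambda>n. d n * x ^ (100 ^ n)) sums g x"
      "\<And>x. x \<in> disk \<Longrightarrow> (\<lambda>n. d n * (100 ^ n * x ^ (100 ^ n - 1))) sums g' x"
      "\<And>x. x \<in> disk \<Longrightarrow> (g has_field_derivative g' x) (at x)"
    by blast
  have eq: "lacunary d x = g x" if "x \<in> disk" for x
    using sums_unique[OF g(1)[OF that]] that by (simp add: lacunary_def)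
  have "(lacunary d has_field_derivative g' z) (at z)"
    using has_field_derivative_transform_within_open[OF g(3)[OF z] open_ball z] eq by metis
  then show "lacunary d field_differentiable at z"
    "(\<lambda>n. d n * (100 ^ n * z ^ (100 ^ n - 1))) sums deriv (lacunary d) z"
    using g(2)[OF z] by (auto simp: field_differentiable_def DERIV_imp_deriv)
  show "(\<lambda>n. d n * z ^ (100 ^ n)) sums lacunary d z"
    using g(1)[OF z] eq[OF z] by simp
qed

text \<open>The bound \<open>2 / (1 - |z|)\<close> of \<open>lacunary_sum_le\<close> passes from
  partial sums to the derivative, and \<open>1 - |z|^2\<close> times it is
  \<open>2 * (1 + |z|) <= 4\<close>.\<close>

lemma lacunary_Bloch:
  assumes d: "\<And>n. cmod (d n) \<le> 1"
  shows "lacunary d \<in> Bloch"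
proof -
  have "(1 - (cmod z)\<^sup>2) * cmod (deriv (lacunary d) z) \<le> 4" if z: "z \<in> disk" for z
  proof -
    have z1: "cmod z < 1" using z by simp
    have "norm (\<Sum>n<N. d n * (100 ^ n * z ^ (100 ^ n - 1))) \<le> 2 / (1 - cmod z)" for N
    proof -
      have "norm (\<Sum>n<N. d n * (100 ^ n * z ^ (100 ^ n - 1))) \<le> (\<Sum>n<N. 100 ^ n * cmod z ^ (100 ^ n - 1))"
        using d by (intro order_trans[OF norm_sum] sum_mono)
          (simp add: norm_mult norm_power mult_left_le_one_le)
      also have "\<dots> \<le> 2 / (1 - cmod z)" using z1 by (intro lacunary_sum_le) auto
      finally show ?thesis .
    qed
    then have "cmod (deriv (lacunary d) z) \<le> 2 / (1 - cmod z)"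
      using lacunary_sums(2)[of d, OF d z, unfolded sums_def, THEN tendsto_norm]
      by (intro Lim_bounded[where M = 0]) auto
    then have "(1 - (cmod z)\<^sup>2) * cmod (deriv (lacunary d) z) \<le> (1 - (cmod z)\<^sup>2) * (2 / (1 - cmod z))"
      using z1 by (intro mult_left_mono) (auto simp: power_le_one)
    also have "\<dots> = 2 * (1 + cmod z)"
      using z1 by (simp add: power2_eq_square field_simps)
    finally show ?thesis using z1 by simp
  qed
  moreover have "lacunary d holomorphic_on disk"
    using lacunary_sums(3)[of d, OF d] by (auto simp: holomorphic_on_def intro: field_differentiable_at_within)
  ultimately show ?thesis
    by (auto simp: Bloch_def H_disk_def lacunary_def intro!: bdd_aboveI[of _ 4])
qed

text \<open>Half-open, with \<open>annulus 0\<close> starting at the origin, so that the annuli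
  partition the disk.\<close>

definition annulus :: "nat \<Rightarrow> complex set"
  where "annulus m = {w. 1 - 1 / 100 ^ m \<le> cmod w \<and> cmod w < 1 - 1 / 100 ^ Suc m}"

lemma annulus_subset_disk: "annulus m \<subseteq> disk"
proof
  fix w assume "w \<in> annulus m"
  then have "cmod w < 1 - 1 / 100 ^ Suc m" by (simp add: annulus_def)
  also have "\<dots> < 1" by simp
  finally show "w \<in> disk" by simp
qed

text \<open>By parity the terms next to index \<open>m\<close> vanish. The remaining lower terms add
  up to at most \<open>100 ^ m / 99\<close>, the higher ones to at most \<open>100 ^ m / 32\<close>,
  and the main term is at least \<open>100 ^ m / 3\<close>, so \<open>100 ^ m / 4\<close>
  survives.\<close>

lemma lacunary_deriv_lower:
  assumes d: "\<And>n. cmod (d n) \<le> 1"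
    and gap: "\<And>n. even n \<noteq> even m \<Longrightarrow> d n = 0"
    and m: "cmod (d m) = 1" and w: "w \<in> annulus m"
  shows "1 / (400 * (1 - (cmod w)\<^sup>2)) \<le> cmod (deriv (lacunary d) w)"
proof -
  have wd: "w \<in> disk" using w annulus_subset_disk by blast
  have w1: "1 - 1 / 100 ^ m \<le> cmod w" "cmod w < 1 - 1 / 100 ^ Suc m"
    using w by (auto simp: annulus_def)
  define f where "f n = d n * (100 ^ n * w ^ (100 ^ n - 1))" for n
  have nf: "norm (f n) \<le> 100 ^ n * cmod w ^ (100 ^ n - 1)" for n
    unfolding f_def using d[of n] by (simp add: norm_mult norm_power mult_left_le_one_le)
  have low: "(\<Sum>n<m. norm (f n)) \<le> 100 ^ m / 99"
  proof (cases m)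
    case (Suc k)
    \<comment> \<open>The last summand has index \<open>m - 1\<close>, of the wrong parity; what is
      left ends at \<open>m - 2\<close>.\<close>
    have "(\<Sum>n<m. norm (f n)) = (\<Sum>n<k. norm (f n))"
      using gap[of k] Suc by (simp add: f_def)
    also have "\<dots> \<le> (\<Sum>n<k. 100 ^ n)"
    proof (rule sum_mono)
      fix n
      have "cmod w ^ (100 ^ n - 1) \<le> 1" using wd by (intro power_le_one) auto
      then have "100 ^ n * cmod w ^ (100 ^ n - 1) \<le> 100 ^ n * 1" by (intro mult_left_mono) auto
      then show "norm (f n) \<le> 100 ^ n" using nf[of n] by linarith
    qed
    also have "\<dots> = (100 ^ k - 1) / 99" by (simp add: geometric_sum)
    also have "\<dots> \<le> 100 ^ m / 99" unfolding Suc by (intro divide_right_mono) (auto intro: order_trans[of _ 0])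
    finally show ?thesis .
  qed simp
  have high: "(\<Sum>j<J. norm (f (m + 2 + j))) \<le> 100 ^ m / 32" for J
  proof -
    have "(\<Sum>j<J. norm (f (m + 2 + j))) \<le> (\<Sum>j<J. 100 ^ m / 33 * (1 / 100) ^ j)"
      using w1 by (intro sum_mono order_trans[OF nf] lacunary_term_upper) auto
    also have "\<dots> = 100 ^ m / 33 * (\<Sum>j<J. (1 / 100) ^ j)" by (rule sum_distrib_left[symmetric])
    also have "(\<Sum>j<J. (1 / 100 :: real) ^ j) = 100 / 99 * (1 - (1 / 100) ^ J)" by (simp add: sum_gp_strict)
    also have "\<dots> \<le> 100 / 99" by simp
    finally have "(\<Sum>j<J. norm (f (m + 2 + j))) \<le> 100 ^ m / 33 * (100 / 99)"
      by (simp add: mult_left_mono)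
    also have "\<dots> \<le> 100 ^ m / 32" by simp
    finally show ?thesis .
  qed
  have main: "100 ^ m / 3 \<le> norm (f m)"
    using lacunary_term_lower[OF w1(1)] m by (simp add: f_def norm_mult norm_power)
  have part: "100 ^ m / 4 \<le> norm (\<Sum>n<m + 2 + J. f n)" for J
  proof -
    have split: "(\<Sum>n<m + 2 + J. f n) = (\<Sum>n<m + 2. f n) + (\<Sum>j<J. f (m + 2 + j))"
      by (induction J) auto
    \<comment> \<open>Index \<open>m + 1\<close> is the one that neither \<open>low\<close> nor
      \<open>high\<close> controls.\<close>
    have "f (Suc m) = 0" using gap[of "Suc m"] by (simp add: f_def)
    then have "f m = (\<Sum>n<m + 2 + J. f n) - (\<Sum>n<m. f n) - (\<Sum>j<J. f (m + 2 + j))"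
      unfolding split by simp
    then have "norm (f m) \<le> norm (\<Sum>n<m + 2 + J. f n) + norm (\<Sum>n<m. f n) + norm (\<Sum>j<J. f (m + 2 + j))"
      by (metis (no_types, lifting) norm_triangle_ineq4 order_trans add_right_mono)
    moreover have "norm (\<Sum>n<m. f n) \<le> 100 ^ m / 99" "norm (\<Sum>j<J. f (m + 2 + j)) \<le> 100 ^ m / 32"
      using order_trans[OF norm_sum low] order_trans[OF norm_sum high] by auto
    moreover have "0 < (100::real) ^ m" by simp
    ultimately show ?thesis using main by linarith
  qed
  have "f sums deriv (lacunary d) w"
    using lacunary_sums(2)[of d, OF d wd] by (simp add: f_def[abs_def])
  then have "(\<lambda>N. norm (\<Sum>n<N. f n)) \<longlonglongrightarrow> cmod (deriv (lacunary d) w)"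
    unfolding sums_def by (rule tendsto_norm)
  then have lim: "(\<lambda>J. norm (\<Sum>n<m + 2 + J. f n)) \<longlonglongrightarrow> cmod (deriv (lacunary d) w)"
    using LIMSEQ_ignore_initial_segment[where k = "m + 2"] by (simp only: add.commute[of _ "m + 2"])
  have "100 ^ m / 4 \<le> cmod (deriv (lacunary d) w)"
    by (rule Lim_bounded2[OF lim, of 0]) (use part in auto)
  \<comment> \<open>On the annulus \<open>1 - |w|^2 >= 1 - |w| >= 1 / 100 ^ Suc m\<close>; the
    constant 400 is this extra 100 times the 4 from above.\<close>
  moreover have "1 / (400 * (1 - (cmod w)\<^sup>2)) \<le> 100 ^ m / 4"
  proof -
    have eq: "1 / (400 * (1 - (cmod w)\<^sup>2)) = 1 / (1 - (cmod w)\<^sup>2) / 400" by simp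
    have "1 / 100 ^ Suc m \<le> 1 - cmod w" using w1 by simp
    also have "\<dots> \<le> 1 - (cmod w)\<^sup>2"
      using wd power_decreasing[of 1 2 "cmod w"] by simp
    finally have "1 / 100 ^ Suc m \<le> 1 - (cmod w)\<^sup>2" .
    moreover have "(cmod w)\<^sup>2 < 1" using wd by (simp add: power_less_one_iff)
    ultimately have "1 / (1 - (cmod w)\<^sup>2) \<le> 1 / (1 / 100 ^ Suc m)"
      by (intro divide_left_mono mult_pos_pos) auto
    also have "\<dots> = 100 * 100 ^ m" by simp
    finally show ?thesis unfolding eq by (rule order_trans[OF divide_right_mono]) simp_all
  qed
  ultimately show ?thesis by linarith
qed

section \<open>Composition and derivative integrals\<close>

lemma space_disk_measure:
  assumes "sets \<mu> = sets (restrict_space borel disk)"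
  shows "space \<mu> = disk"
  using sets_eq_imp_space_eq[OF assms] by (simp add: space_restrict_space)

lemma continuous_on_disk_measurable:
  fixes h :: "complex \<Rightarrow> 'b::topological_space"
  assumes "sets \<mu> = sets (restrict_space borel disk)" "continuous_on disk h"
  shows "h \<in> borel_measurable \<mu>"
  unfolding measurable_cong_sets[OF assms(1) refl]
  by (rule borel_measurable_continuous_on_restrict[OF assms(2)])

lemma deriv_comp_disk:
  assumes "f holomorphic_on disk" "\<psi> holomorphic_on disk" "\<psi> ` disk \<subseteq> disk" "z \<in> disk"
  shows "deriv (f \<circ> \<psi>) z = deriv f (\<psi> z) * deriv \<psi> z"
  using assms by (intro deriv_chain) (auto intro!: holomorphic_on_imp_differentiable_at[OF _ open_ball])

lemma Aut_diskD:
  assumes "\<sigma> \<in> Aut_disk"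
  shows "\<sigma> holomorphic_on disk" "\<sigma> ` disk = disk" "self_map \<sigma>"
  using assms by (auto simp: Aut_disk_def bij_betw_def self_map_def)

lemma id_Aut_disk: "id \<in> Aut_disk"
  by (simp add: Aut_disk_def holomorphic_on_id bij_betw_id)

lemma self_map_comp_Aut:
  assumes "self_map \<phi>" "\<sigma> \<in> Aut_disk"
  shows "self_map (\<phi> \<circ> \<sigma>)"
  using assms Aut_diskD[OF assms(2)] unfolding self_map_def image_comp[symmetric]
  by (auto intro!: holomorphic_on_compose)

lemma H_disk_comp_holomorphic:
  assumes "f \<in> H_disk" "self_map \<psi>"
  shows "(f \<circ> \<psi>) holomorphic_on disk"
  using assms by (auto simp: H_disk_def self_map_def intro!: holomorphic_on_compose_gen[of _ _ _ disk])

lemma deriv_powr_measurable: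
  assumes "sets \<mu> = sets (restrict_space borel disk)" "f holomorphic_on disk"
  shows "(\<lambda>z. ennreal (cmod (deriv f z) powr p)) \<in> borel_measurable \<mu>"
proof -
  have "deriv f \<in> borel_measurable \<mu>"
    by (rule continuous_on_disk_measurable[OF assms(1)])
      (auto intro!: holomorphic_on_imp_continuous_on holomorphic_deriv assms)
  then show ?thesis by measurable
qed

section \<open>The norm of the Moebius invariant space\<close>

text \<open>The value at \<open>0\<close> and the integral for a single automorphism are kept together, so that the
  norm of \<open>M_space\<close> becomes a supremum of \<open>L\<^sup>p\<close>-norms.\<close>

definition M_fun :: "complex measure \<Rightarrow> real \<Rightarrow> (complex \<Rightarrow> complex) \<Rightarrow> (complex \<Rightarrow> complex) \<Rightarrow> ennreal"
  where "M_fun \<mu> p \<sigma> f = ennreal (cmod (f 0) powr p) + deriv_integral \<mu> p (f \<circ> \<sigma>)"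

lemma M_norm_nonneg: "0 \<le> M_norm \<mu> p f"
  by (simp add: M_norm_def)

text \<open>A constant summand passes through the nonempty supremum, so a bound on the norm can be
  checked for one automorphism at a time.\<close>

lemma M_norm_le_iff:
  assumes "1 \<le> p" "f \<in> M_space \<mu> p" "0 \<le> x"
  shows "M_norm \<mu> p f \<le> x \<longleftrightarrow> (\<forall>\<sigma>\<in>Aut_disk. M_fun \<mu> p \<sigma> f \<le> ennreal (x powr p))"
proof -
  define S where "S = (SUP \<sigma>\<in>Aut_disk. deriv_integral \<mu> p (f \<circ> \<sigma>))"
  define a where "a = cmod (f 0) powr p"
  have S: "S < \<infinity>" using assms(2) by (simp add: M_space_def S_def)
  have ne: "Aut_disk \<noteq> {}" using id_Aut_disk by blast
  have a: "0 \<le> a" by (simp add: a_def)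
  have "M_norm \<mu> p f \<le> x \<longleftrightarrow> M_norm \<mu> p f powr p \<le> x powr p"
    using assms powr_mono2[of p "M_norm \<mu> p f" x] powr_less_mono2[of p x "M_norm \<mu> p f"]
      M_norm_nonneg[of \<mu> p f] by linarith
  also have "M_norm \<mu> p f powr p = a + enn2real S"
    using assms(1) a by (simp add: M_norm_def powr_powr a_def[symmetric] S_def[symmetric])
  also have "a + enn2real S \<le> x powr p \<longleftrightarrow> ennreal (a + enn2real S) \<le> ennreal (x powr p)"
    by simp
  also have "ennreal (a + enn2real S) = ennreal a + S"
    using S a by (simp add: ennreal_plus)
  also have "ennreal a + S = (SUP \<sigma>\<in>Aut_disk. ennreal a + deriv_integral \<mu> p (f \<circ> \<sigma>))"
    unfolding S_def by (rule ennreal_SUP_add_right[OF ne])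
  also have "\<dots> \<le> ennreal (x powr p) \<longleftrightarrow> (\<forall>\<sigma>\<in>Aut_disk. M_fun \<mu> p \<sigma> f \<le> ennreal (x powr p))"
    by (simp add: SUP_le_iff M_fun_def a_def)
  finally show ?thesis .
qed

lemma M_spaceI:
  assumes "f \<in> H_disk" "\<And>\<sigma>. \<sigma> \<in> Aut_disk \<Longrightarrow> M_fun \<mu> p \<sigma> f \<le> ennreal x"
  shows "f \<in> M_space \<mu> p"
proof -
  have "(SUP \<sigma>\<in>Aut_disk. deriv_integral \<mu> p (f \<circ> \<sigma>)) \<le> ennreal x"
    using assms(2) unfolding M_fun_def by (intro SUP_least) (metis add_increasing order_trans zero_le le_iff_add add.commute)
  then show ?thesis using assms(1) by (auto simp: M_space_def intro: le_less_trans)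
qed

section \<open>Convexity and the triangle inequality\<close>

text \<open>If one argument is 0, convexity reduces to \<open>l powr p <= l\<close> for a weight
  \<open>l\<close> between 0 and 1.\<close>

lemma convex_on_powr_nonneg:
  fixes p :: real
  assumes "1 \<le> p"
  shows "convex_on {0..} (\<lambda>x. x powr p)"
proof (rule convex_onI)
  fix t x y :: real
  assume t: "0 < t" "t < 1" and xy: "x \<in> {0..}" "y \<in> {0..}"
  have le: "(l * a) powr p \<le> l * a powr p" if "0 < l" "l < 1" "0 \<le> a" for l a :: real
  proof -
    have "l powr p \<le> l powr 1" using that assms by (intro powr_mono') auto
    then have "l powr p * a powr p \<le> l * a powr p" using that by (intro mult_right_mono) auto
    then show ?thesis using that by (simp add: powr_mult)
  qed
  show "((1 - t) *\<^sub>R x + t *\<^sub>R y) powr p \<le> (1 - t) * x powr p + t * y powr p"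
  proof (cases "0 < x \<and> 0 < y")
    case True
    then show ?thesis
      using convex_onD[OF powr_convex[OF assms], of t x y] t by auto
  next
    case False
    then consider "x = 0" | "y = 0" using xy by force
    then show ?thesis using le[of t y] le[of "1 - t" x] t xy by cases auto
  qed
qed simp

text \<open>The coefficients are those for which integrating the bound yields the triangle inequality
  for functions of norms \<open>s\<close> and \<open>t\<close>.\<close>

lemma norm_add_powr_le:
  fixes x y :: complex
  assumes "1 \<le> p" "0 < s" "0 < t"
  shows "cmod (x + y) powr p
    \<le> ((s + t) / s) powr (p - 1) * cmod x powr p + ((s + t) / t) powr (p - 1) * cmod y powr p"
proof -
  have w: "1 - t / (s + t) = s / (s + t)" using assms by (simp add: field_simps)
  have sc: "(s + t) powr p * (u / (s + t) * (a / u) powr p) = ((s + t) / u) powr (p - 1) * a powr p"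
    if "0 < u" "0 \<le> a" for u a
    using that assms by (simp add: powr_divide powr_diff field_simps)
  \<comment> \<open>Convexity is applied to the normalized values \<open>cmod x / s\<close> and
    \<open>cmod y / t\<close> with weights \<open>s / (s + t)\<close> and
    \<open>t / (s + t)\<close>.\<close>
  have "(s / (s + t)) * (cmod x / s) + (t / (s + t)) * (cmod y / t) = (cmod x + cmod y) / (s + t)"
    using assms by (simp add: add_divide_distrib)
  then have "((cmod x + cmod y) / (s + t)) powr p
      \<le> (s / (s + t)) * (cmod x / s) powr p + (t / (s + t)) * (cmod y / t) powr p"
    using convex_onD[OF convex_on_powr_nonneg[OF assms(1)], of "t / (s + t)" "cmod x / s" "cmod y / t"] assms
    by (simp add: w)
  then have "(s + t) powr p * ((cmod x + cmod y) / (s + t)) powr p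
      \<le> (s + t) powr p * ((s / (s + t)) * (cmod x / s) powr p + (t / (s + t)) * (cmod y / t) powr p)"
    by (intro mult_left_mono) auto
  also have "(s + t) powr p * ((cmod x + cmod y) / (s + t)) powr p = (cmod x + cmod y) powr p"
    using assms by (simp add: powr_divide)
  also have "(s + t) powr p * ((s / (s + t)) * (cmod x / s) powr p + (t / (s + t)) * (cmod y / t) powr p)
    = ((s + t) / s) powr (p - 1) * cmod x powr p + ((s + t) / t) powr (p - 1) * cmod y powr p"
    using assms by (simp only: distrib_left sc norm_ge_zero)
  finally have "(cmod x + cmod y) powr p
    \<le> ((s + t) / s) powr (p - 1) * cmod x powr p + ((s + t) / t) powr (p - 1) * cmod y powr p" .
  moreover have "cmod (x + y) powr p \<le> (cmod x + cmod y) powr p"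
    using assms by (intro powr_mono2 norm_triangle_ineq) auto
  ultimately show ?thesis by linarith
qed

text \<open>The weights stay free: adapted to the norms they give the triangle inequality, and
  \<open>s = t = 1\<close> gives the vanishing limit for sums in \<open>M0_space\<close>.\<close>

lemma deriv_integral_add_le:
  assumes "sets \<mu> = sets (restrict_space borel disk)" "1 \<le> p" "0 < s" "0 < t"
    and f: "f holomorphic_on disk" and g: "g holomorphic_on disk"
  shows "deriv_integral \<mu> p (\<lambda>z. f z + g z)
    \<le> ennreal (((s + t) / s) powr (p - 1)) * deriv_integral \<mu> p f
      + ennreal (((s + t) / t) powr (p - 1)) * deriv_integral \<mu> p g"
proof -
  note meas = deriv_powr_measurable[OF assms(1) f, of p] deriv_powr_measurable[OF assms(1) g, of p]
  have "deriv_integral \<mu> p (\<lambda>z. f z + g z)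
    \<le> (\<integral>\<^sup>+ z. ennreal (((s + t) / s) powr (p - 1)) * ennreal (cmod (deriv f z) powr p)
        + ennreal (((s + t) / t) powr (p - 1)) * ennreal (cmod (deriv g z) powr p) \<partial>\<mu>)"
    unfolding deriv_integral_def
  proof (rule nn_integral_mono)
    fix z assume "z \<in> space \<mu>"
    then have z: "z \<in> disk" using space_disk_measure[OF assms(1)] by simp
    have "deriv (\<lambda>z. f z + g z) z = deriv f z + deriv g z"
      using f g z by (intro deriv_add) (auto intro!: holomorphic_on_imp_differentiable_at[OF _ open_ball])
    then show "ennreal (cmod (deriv (\<lambda>z. f z + g z) z) powr p)
      \<le> ennreal (((s + t) / s) powr (p - 1)) * ennreal (cmod (deriv f z) powr p)
        + ennreal (((s + t) / t) powr (p - 1)) * ennreal (cmod (deriv g z) powr p)"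
      using norm_add_powr_le[OF assms(2-4), of "deriv f z" "deriv g z"]
      by (simp flip: ennreal_mult ennreal_plus)
  qed
  also have "\<dots> = ennreal (((s + t) / s) powr (p - 1)) * deriv_integral \<mu> p f
      + ennreal (((s + t) / t) powr (p - 1)) * deriv_integral \<mu> p g"
    unfolding deriv_integral_def
    by (simp add: nn_integral_add nn_integral_cmult meas borel_measurable_times_ennreal)
  finally show ?thesis .
qed

lemma deriv_integral_cmult:
  assumes "sets \<mu> = sets (restrict_space borel disk)"
    and f: "f holomorphic_on disk"
  shows "deriv_integral \<mu> p (\<lambda>z. c * f z) = ennreal (cmod c powr p) * deriv_integral \<mu> p f"
proof -
  have "deriv_integral \<mu> p (\<lambda>z. c * f z)
    = (\<integral>\<^sup>+ z. ennreal (cmod c powr p) * ennreal (cmod (deriv f z) powr p) \<partial>\<mu>)"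
    unfolding deriv_integral_def
  proof (rule nn_integral_cong)
    fix z assume "z \<in> space \<mu>"
    then have z: "z \<in> disk" using space_disk_measure[OF assms(1)] by simp
    have "deriv (\<lambda>z. c * f z) z = c * deriv f z"
      using f z by (intro deriv_cmult) (auto intro!: holomorphic_on_imp_differentiable_at[OF _ open_ball])
    then show "ennreal (cmod (deriv (\<lambda>z. c * f z) z) powr p)
      = ennreal (cmod c powr p) * ennreal (cmod (deriv f z) powr p)"
      by (simp add: norm_mult powr_mult ennreal_mult)
  qed
  also have "\<dots> = ennreal (cmod c powr p) * deriv_integral \<mu> p f"
    unfolding deriv_integral_def by (rule nn_integral_cmult[OF deriv_powr_measurable[OF assms(1) f]])
  finally show ?thesis .
qed

text \<open>This is Minkowski's inequality for the value at 0 and the integral together. The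
  coefficients turn \<open>s powr p\<close> and \<open>t powr p\<close> into
  \<open>(s + t) powr (p - 1)\<close> times \<open>s\<close> and \<open>t\<close>, with sum
  \<open>(s + t) powr p\<close>.\<close>

lemma M_fun_add_le:
  assumes \<mu>: "sets \<mu> = sets (restrict_space borel disk)" and p: "1 \<le> p" and st: "0 < s" "0 < t"
    and f: "f \<in> H_disk" and g: "g \<in> H_disk" and \<sigma>: "\<sigma> \<in> Aut_disk"
    and fs: "M_fun \<mu> p \<sigma> f \<le> ennreal (s powr p)" and gt: "M_fun \<mu> p \<sigma> g \<le> ennreal (t powr p)"
  shows "M_fun \<mu> p \<sigma> (\<lambda>z. f z + g z) \<le> ennreal ((s + t) powr p)"
proof -
  define A where "A = ((s + t) / s) powr (p - 1)"
  define B where "B = ((s + t) / t) powr (p - 1)"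
  have AB: "0 \<le> A" "0 \<le> B" by (simp_all add: A_def B_def)
  have eq: "((s + t) / u) powr (p - 1) * u powr p = (s + t) powr (p - 1) * u" if "0 < u" for u
    using that st by (simp add: powr_divide powr_diff)
  have "ennreal (cmod (f 0 + g 0) powr p) \<le> ennreal A * ennreal (cmod (f 0) powr p) + ennreal B * ennreal (cmod (g 0) powr p)"
    using norm_add_powr_le[OF p st, of "f 0" "g 0"] by (simp add: A_def B_def flip: ennreal_mult ennreal_plus)
  note le1 = this
  have le2: "deriv_integral \<mu> p ((\<lambda>z. f z + g z) \<circ> \<sigma>)
      \<le> ennreal A * deriv_integral \<mu> p (f \<circ> \<sigma>) + ennreal B * deriv_integral \<mu> p (g \<circ> \<sigma>)"
    using deriv_integral_add_le[OF \<mu> p st, of "f \<circ> \<sigma>" "g \<circ> \<sigma>"]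
      H_disk_comp_holomorphic[OF f Aut_diskD(3)[OF \<sigma>]] H_disk_comp_holomorphic[OF g Aut_diskD(3)[OF \<sigma>]]
    by (simp add: o_def A_def B_def)
  have "M_fun \<mu> p \<sigma> (\<lambda>z. f z + g z) \<le> ennreal A * M_fun \<mu> p \<sigma> f + ennreal B * M_fun \<mu> p \<sigma> g"
    unfolding M_fun_def using add_mono[OF le1 le2] by (simp only: distrib_left ac_simps)
  also have "\<dots> \<le> ennreal A * ennreal (s powr p) + ennreal B * ennreal (t powr p)"
    by (intro add_mono mult_left_mono fs gt) auto
  also have "\<dots> = ennreal (A * s powr p + B * t powr p)"
    using AB by (simp flip: ennreal_mult ennreal_plus)
  also have "A * s powr p + B * t powr p = (s + t) powr (p - 1) * (s + t)"
    unfolding A_def B_def using st by (simp only: eq distrib_left)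
  also have "\<dots> = (s + t) powr p"
    using st by (simp add: powr_diff)
  finally show ?thesis .
qed

lemma M_fun_le_M_norm:
  assumes "1 \<le> p" "f \<in> M_space \<mu> p" "\<sigma> \<in> Aut_disk" "M_norm \<mu> p f \<le> x"
  shows "M_fun \<mu> p \<sigma> f \<le> ennreal (x powr p)"
  using M_norm_le_iff[OF assms(1,2), of x] order_trans[OF M_norm_nonneg assms(4)] assms by blast

lemma M_space_add:
  assumes \<mu>: "sets \<mu> = sets (restrict_space borel disk)" and p: "1 \<le> p"
    and f: "f \<in> M_space \<mu> p" and g: "g \<in> M_space \<mu> p"
  shows "(\<lambda>z. f z + g z) \<in> M_space \<mu> p"
    and "M_norm \<mu> p (\<lambda>z. f z + g z) \<le> M_norm \<mu> p f + M_norm \<mu> p g"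
proof -
  have H: "f \<in> H_disk" "g \<in> H_disk" using f g by (auto simp: M_space_def)
  \<comment> \<open>A norm may be 0, while \<open>M_fun_add_le\<close> divides by its weights; hence
    the slack \<open>e\<close>, which is removed at the end.\<close>
  have le: "M_fun \<mu> p \<sigma> (\<lambda>z. f z + g z) \<le> ennreal (((M_norm \<mu> p f + e) + (M_norm \<mu> p g + e)) powr p)"
    if "\<sigma> \<in> Aut_disk" "0 < e" for \<sigma> e
    using that M_norm_nonneg[of \<mu> p f] M_norm_nonneg[of \<mu> p g]
    by (intro M_fun_add_le[OF \<mu> p _ _ H] M_fun_le_M_norm[OF p] f g) auto
  show M: "(\<lambda>z. f z + g z) \<in> M_space \<mu> p"
    using H by (intro M_spaceI[OF _ le[where e = 1]]) (auto simp: H_disk_def intro!: holomorphic_intros)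
  show "M_norm \<mu> p (\<lambda>z. f z + g z) \<le> M_norm \<mu> p f + M_norm \<mu> p g"
  proof (rule field_le_epsilon)
    fix e :: real assume "0 < e"
    moreover have "0 \<le> (M_norm \<mu> p f + e / 2) + (M_norm \<mu> p g + e / 2)"
      using \<open>0 < e\<close> M_norm_nonneg[of \<mu> p f] M_norm_nonneg[of \<mu> p g] by linarith
    ultimately have "M_norm \<mu> p (\<lambda>z. f z + g z) \<le> (M_norm \<mu> p f + e / 2) + (M_norm \<mu> p g + e / 2)"
      unfolding M_norm_le_iff[OF p M \<open>0 \<le> _\<close>] using le by (meson half_gt_zero)
    then show "M_norm \<mu> p (\<lambda>z. f z + g z) \<le> M_norm \<mu> p f + M_norm \<mu> p g + e" by simp
  qed
qed

lemma deriv_integral_comp_cmult: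
  assumes "sets \<mu> = sets (restrict_space borel disk)" "f \<in> H_disk" "\<sigma> \<in> Aut_disk"
  shows "deriv_integral \<mu> p ((\<lambda>z. c * f z) \<circ> \<sigma>) = ennreal (cmod c powr p) * deriv_integral \<mu> p (f \<circ> \<sigma>)"
  using deriv_integral_cmult[OF assms(1) H_disk_comp_holomorphic[OF assms(2) Aut_diskD(3)[OF assms(3)]]]
  by (simp add: o_def)

lemma M_space_cmult:
  assumes \<mu>: "sets \<mu> = sets (restrict_space borel disk)" and p: "1 \<le> p" and f: "f \<in> M_space \<mu> p"
  shows "(\<lambda>z. c * f z) \<in> M_space \<mu> p"
    and "M_norm \<mu> p (\<lambda>z. c * f z) = cmod c * M_norm \<mu> p f"
proof -
  have H: "f \<in> H_disk" and fin: "(SUP \<sigma>\<in>Aut_disk. deriv_integral \<mu> p (f \<circ> \<sigma>)) < \<infinity>"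
    using f by (auto simp: M_space_def)
  have eq: "(SUP \<sigma>\<in>Aut_disk. deriv_integral \<mu> p ((\<lambda>z. c * f z) \<circ> \<sigma>))
      = ennreal (cmod c powr p) * (SUP \<sigma>\<in>Aut_disk. deriv_integral \<mu> p (f \<circ> \<sigma>))"
    by (simp add: deriv_integral_comp_cmult[OF \<mu> H] SUP_mult_left_ennreal)
  show "(\<lambda>z. c * f z) \<in> M_space \<mu> p"
    using H fin unfolding M_space_def mem_Collect_eq eq
    by (auto simp: H_disk_def ennreal_mult_less_top intro!: holomorphic_intros)
  show "M_norm \<mu> p (\<lambda>z. c * f z) = cmod c * M_norm \<mu> p f"
  proof -
    define S where "S = enn2real (SUP \<sigma>\<in>Aut_disk. deriv_integral \<mu> p (f \<circ> \<sigma>))"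
    have "cmod (c * f 0) powr p + enn2real (ennreal (cmod c powr p) * (SUP \<sigma>\<in>Aut_disk. deriv_integral \<mu> p (f \<circ> \<sigma>)))
        = cmod c powr p * (cmod (f 0) powr p + S)"
      by (simp add: enn2real_mult norm_mult powr_mult S_def distrib_left)
    then show ?thesis
      unfolding M_norm_def eq S_def[symmetric] using p
      by (simp add: powr_mult powr_powr S_def)
  qed
qed

lemma normed_fun_space_M0:
  assumes \<mu>: "sets \<mu> = sets (restrict_space borel disk)" and p: "1 \<le> p" and ax: "standing_axiom \<mu> p"
  shows "normed_fun_space (M0_space \<mu> p) (M_norm \<mu> p)"
  unfolding normed_fun_space_def
proof (intro conjI ballI allI impI)
  have z: "deriv_integral \<mu> p ((\<lambda>_. 0) \<circ> \<sigma>) = 0" for \<sigma>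
    using p by (simp add: deriv_integral_def o_def)
  show "(\<lambda>_. 0) \<in> M0_space \<mu> p"
    unfolding M0_space_def M_space_def mem_Collect_eq z
    using id_Aut_disk by (subst SUP_const) (auto simp: H_disk_def)
next
  fix f g assume fg: "f \<in> M0_space \<mu> p" "g \<in> M0_space \<mu> p"
  then have M: "f \<in> M_space \<mu> p" "g \<in> M_space \<mu> p"
    and lim: "((\<lambda>\<sigma>. deriv_integral \<mu> p (f \<circ> \<sigma>)) \<longlongrightarrow> 0) aut_boundary"
      "((\<lambda>\<sigma>. deriv_integral \<mu> p (g \<circ> \<sigma>)) \<longlongrightarrow> 0) aut_boundary"
    by (auto simp: M0_space_def)
  have H: "f \<in> H_disk" "g \<in> H_disk" using M by (auto simp: M_space_def)
  show "M_norm \<mu> p (\<lambda>z. f z + g z) \<le> M_norm \<mu> p f + M_norm \<mu> p g"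
    by (rule M_space_add(2)[OF \<mu> p M])
  define A where "A = ennreal (2 powr (p - 1))"
  have "((\<lambda>\<sigma>. deriv_integral \<mu> p ((\<lambda>z. f z + g z) \<circ> \<sigma>)) \<longlongrightarrow> 0) aut_boundary"
  proof (rule tendsto_sandwich[where f = "\<lambda>_. 0" and h = "\<lambda>\<sigma>. A * deriv_integral \<mu> p (f \<circ> \<sigma>) + A * deriv_integral \<mu> p (g \<circ> \<sigma>)"])
    show "((\<lambda>\<sigma>. A * deriv_integral \<mu> p (f \<circ> \<sigma>) + A * deriv_integral \<mu> p (g \<circ> \<sigma>)) \<longlongrightarrow> 0) aut_boundary"
      using tendsto_add[OF ennreal_tendsto_cmult[OF _ lim(1), of A] ennreal_tendsto_cmult[OF _ lim(2), of A]]
      by (simp add: A_def)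
    have "deriv_integral \<mu> p ((\<lambda>z. f z + g z) \<circ> \<sigma>)
        \<le> A * deriv_integral \<mu> p (f \<circ> \<sigma>) + A * deriv_integral \<mu> p (g \<circ> \<sigma>)" if "\<sigma> \<in> Aut_disk" for \<sigma>
      using deriv_integral_add_le[OF \<mu> p, of 1 1 "f \<circ> \<sigma>" "g \<circ> \<sigma>"] that
        H_disk_comp_holomorphic[OF H(1) Aut_diskD(3)] H_disk_comp_holomorphic[OF H(2) Aut_diskD(3)]
      by (simp add: o_def A_def)
    then show "\<forall>\<^sub>F \<sigma> in aut_boundary. deriv_integral \<mu> p ((\<lambda>z. f z + g z) \<circ> \<sigma>)
        \<le> A * deriv_integral \<mu> p (f \<circ> \<sigma>) + A * deriv_integral \<mu> p (g \<circ> \<sigma>)"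
      by (auto simp: eventually_aut_boundary intro!: exI[of _ 0])
  qed auto
  then show "(\<lambda>z. f z + g z) \<in> M0_space \<mu> p"
    using M_space_add(1)[OF \<mu> p M] by (simp only: M0_space_def mem_Collect_eq simp_thms)
next
  fix c f assume f: "f \<in> M0_space \<mu> p"
  then have M: "f \<in> M_space \<mu> p" and H: "f \<in> H_disk"
    and lim: "((\<lambda>\<sigma>. deriv_integral \<mu> p (f \<circ> \<sigma>)) \<longlongrightarrow> 0) aut_boundary"
    by (auto simp: M0_space_def M_space_def)
  show "M_norm \<mu> p (\<lambda>z. c * f z) = cmod c * M_norm \<mu> p f"
    by (rule M_space_cmult(2)[OF \<mu> p M])
  have "((\<lambda>\<sigma>. ennreal (cmod c powr p) * deriv_integral \<mu> p (f \<circ> \<sigma>)) \<longlongrightarrow> 0) aut_boundary"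
    using ennreal_tendsto_cmult[OF _ lim, of "ennreal (cmod c powr p)"] by simp
  moreover have "\<forall>\<^sub>F \<sigma> in aut_boundary. ennreal (cmod c powr p) * deriv_integral \<mu> p (f \<circ> \<sigma>)
      = deriv_integral \<mu> p ((\<lambda>z. c * f z) \<circ> \<sigma>)"
    by (auto simp: eventually_aut_boundary deriv_integral_comp_cmult[OF \<mu> H] intro!: exI[of _ 0])
  ultimately show "(\<lambda>z. c * f z) \<in> M0_space \<mu> p"
    using M_space_cmult(1)[OF \<mu> p M] by (simp only: M0_space_def mem_Collect_eq simp_thms Lim_transform_eventually)
next
  fix f assume "f \<in> M0_space \<mu> p"
  then have M: "f \<in> M_space \<mu> p" and H: "f \<in> H_disk"
    by (auto simp: M0_space_def M_space_def)
  show "0 \<le> M_norm \<mu> p f" by (rule M_norm_nonneg)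
  assume "M_norm \<mu> p f = 0"
  \<comment> \<open>The identity automorphism reduces definiteness to that of \<open>D_norm\<close>,
    which the standing axiom provides.\<close>
  then have "M_fun \<mu> p id f \<le> ennreal (0 powr p)"
    by (intro M_fun_le_M_norm[OF p M id_Aut_disk]) simp
  then have "cmod (f 0) powr p = 0" "deriv_integral \<mu> p f = 0"
    by (auto simp: M_fun_def)
  then have "f \<in> D_space \<mu> p" "D_norm \<mu> p f = 0"
    using H p by (auto simp: D_space_def D_norm_def)
  then show "f = (\<lambda>_. 0)"
    using ax normed_fun_spaceD(6)[of "D_space \<mu> p" "D_norm \<mu> p" f]
    by (auto simp: standing_axiom_def banach_fun_space_def)
qed

section \<open>Separated families, and the covering of the disk by annuli\<close>

text \<open>Each point has a member of a countable dense set within \<open>\<eta> / 2\<close>; two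
  points sharing it would be closer than \<open>\<eta>\<close>, so the choice is injective.\<close>

lemma (in Metric_space) separable_imp_countable_separated:
  assumes "separable_space mtopology" "0 < \<eta>"
    and g: "\<And>i. i \<in> I \<Longrightarrow> g i \<in> M"
    and sep: "\<And>i j. i \<in> I \<Longrightarrow> j \<in> I \<Longrightarrow> i \<noteq> j \<Longrightarrow> \<eta> \<le> d (g i) (g j)"
  shows "countable I"
proof -
  obtain C where C: "countable C" "C \<subseteq> M" "mtopology closure_of C = M"
    using assms(1) by (auto simp: separable_space_def)
  have "\<exists>c\<in>C. d (g i) c < \<eta> / 2" if "i \<in> I" for i
  proof -
    have "g i \<in> mtopology closure_of C" using g[OF that] C by simp
    then show ?thesis using \<open>0 < \<eta>\<close> by (auto simp: metric_closure_of dest!: spec[of _ "\<eta> / 2"])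
  qed
  then obtain c where c: "\<And>i. i \<in> I \<Longrightarrow> c i \<in> C" "\<And>i. i \<in> I \<Longrightarrow> d (g i) (c i) < \<eta> / 2"
    by metis
  have "inj_on c I"
  proof (rule inj_onI, rule ccontr)
    fix i j assume ij: "i \<in> I" "j \<in> I" "c i = c j" "i \<noteq> j"
    have "d (g i) (g j) \<le> d (g i) (c i) + d (c i) (g j)"
      using ij c(1)[of i] g C(2) by (intro triangle) auto
    also have "d (c i) (g j) = d (g j) (c j)" using ij by (simp add: commute)
    finally show False using c(2)[of i] c(2)[of j] sep[of i j] ij by linarith
  qed
  moreover have "c ` I \<subseteq> C" using c(1) by blast
  ultimately show ?thesis using C(1) countable_subset countable_image_inj_on by blast
qed

lemma uncountable_nat_sets: "uncountable (UNIV :: nat set set)"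
proof
  assume "countable (UNIV :: nat set set)"
  then have "range (from_nat_into (UNIV :: nat set set)) = Pow UNIV"
    by (subst range_from_nat_into) auto
  then show False using Cantors_theorem[of "UNIV :: nat set"] by blast
qed

text \<open>The least \<open>m\<close> whose outer radius exceeds \<open>cmod w\<close> works:
  minimality gives the inner bound, which for \<open>m = 0\<close> is just
  \<open>0 <= cmod w\<close>.\<close>

lemma ex_annulus:
  assumes "w \<in> disk" "1 - 1 / 100 ^ M \<le> cmod w"
  shows "\<exists>m\<ge>M. w \<in> annulus m"
proof -
  have "\<exists>m. cmod w < 1 - 1 / 100 ^ Suc m"
  proof -
    obtain n where "(1 / 100) ^ n < 1 - cmod w"
      using real_arch_pow_inv[of "1 - cmod w" "1 / 100"] assms(1) by auto
    moreover have "(1 / 100 :: real) ^ Suc n \<le> (1 / 100) ^ n" by simp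
    ultimately have "cmod w < 1 - 1 / 100 ^ Suc n" unfolding power_divide power_one by linarith
    then show ?thesis by blast
  qed
  then obtain m where m: "cmod w < 1 - 1 / 100 ^ Suc m"
    and min: "\<And>k. k < m \<Longrightarrow> \<not> cmod w < 1 - 1 / 100 ^ Suc k"
    using exists_least_iff[of "\<lambda>m. cmod w < 1 - 1 / 100 ^ Suc m"] by blast
  have "1 - 1 / 100 ^ m \<le> cmod w"
  proof (cases m)
    case (Suc k)
    then show ?thesis using min[of k] by simp
  qed simp
  then have "w \<in> annulus m" using m by (simp add: annulus_def)
  moreover have "M \<le> m"
  proof (rule ccontr)
    assume "\<not> M \<le> m"
    then have "(100::real) ^ Suc m \<le> 100 ^ M" by (intro power_increasing) auto
    then have "1 / 100 ^ M \<le> (1::real) / 100 ^ Suc m" by (intro divide_left_mono) auto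
    then show False using m assms(2) by linarith
  qed
  ultimately show ?thesis by blast
qed

lemma annulus_borel: "annulus m \<in> sets borel"
proof -
  have "annulus m = ball 0 (1 - 1 / 100 ^ Suc m) - ball 0 (1 - 1 / 100 ^ m)"
    by (auto simp: annulus_def)
  then show ?thesis by simp
qed

lemma UN_annulus_borel: "(\<Union>m\<in>A. annulus m) \<in> sets borel"
  by (intro sets.countable_UN'') (auto intro: annulus_borel)

section \<open>The hyperbolic measure\<close>

text \<open>Transporting the hyperbolic density to the image side makes the integrals of all
  \<open>f \<circ> \<psi>\<close> integrals against one measure, and lets the mass be located by
  regions of \<open>w\<close>. The target is the whole plane; for a self-map the mass sits in the
  disk.\<close>

definition hyp_measure :: "complex measure \<Rightarrow> real \<Rightarrow> (complex \<Rightarrow> complex) \<Rightarrow> complex measure"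
  where "hyp_measure \<mu> p \<psi> = distr (density \<mu> (\<lambda>z. ennreal (hyp_deriv \<psi> z powr p))) borel \<psi>"

lemma sets_hyp_measure [simp]: "sets (hyp_measure \<mu> p \<psi>) = sets borel"
  by (simp add: hyp_measure_def)

lemma space_hyp_measure [simp]: "space (hyp_measure \<mu> p \<psi>) = UNIV"
  by (simp add: hyp_measure_def)

lemma self_map_measurable:
  assumes "sets \<mu> = sets (restrict_space borel disk)" "self_map \<psi>"
  shows "\<psi> \<in> borel_measurable \<mu>"
  using assms by (auto simp: self_map_def intro!: continuous_on_disk_measurable holomorphic_on_imp_continuous_on)

lemma hyp_deriv_measurable:
  assumes \<mu>: "sets \<mu> = sets (restrict_space borel disk)" and \<psi>: "self_map \<psi>"
  shows "(\<lambda>z. ennreal (hyp_deriv \<psi> z powr p)) \<in> borel_measurable \<mu>"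
proof -
  have [measurable]: "deriv \<psi> \<in> borel_measurable \<mu>" "\<psi> \<in> borel_measurable \<mu>"
    using \<psi> by (auto simp: self_map_def intro!: continuous_on_disk_measurable[OF \<mu>]
        holomorphic_on_imp_continuous_on holomorphic_deriv)
  show ?thesis unfolding hyp_deriv_def by measurable
qed

lemma nn_integral_hyp_measure:
  assumes \<mu>: "sets \<mu> = sets (restrict_space borel disk)" and \<psi>: "self_map \<psi>"
    and h: "h \<in> borel_measurable borel"
  shows "(\<integral>\<^sup>+ w. h w \<partial>hyp_measure \<mu> p \<psi>) = (\<integral>\<^sup>+ z. ennreal (hyp_deriv \<psi> z powr p) * h (\<psi> z) \<partial>\<mu>)"
proof -
  note [measurable] = self_map_measurable[OF \<mu> \<psi>] hyp_deriv_measurable[OF \<mu> \<psi>, of p] h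
  have "(\<integral>\<^sup>+ w. h w \<partial>hyp_measure \<mu> p \<psi>) = (\<integral>\<^sup>+ z. h (\<psi> z) \<partial>density \<mu> (\<lambda>z. ennreal (hyp_deriv \<psi> z powr p)))"
    unfolding hyp_measure_def by (rule nn_integral_distr) measurable
  also have "\<dots> = (\<integral>\<^sup>+ z. ennreal (hyp_deriv \<psi> z powr p) * h (\<psi> z) \<partial>\<mu>)"
    by (rule nn_integral_density) measurable
  finally show ?thesis .
qed

text \<open>The first form serves upper estimates of integrals over the plane, the second the
  covering of the disk by annuli.\<close>

lemma hyp_integral_eq:
  assumes \<mu>: "sets \<mu> = sets (restrict_space borel disk)" and \<psi>: "self_map \<psi>"
  shows "hyp_integral \<mu> p \<psi> = emeasure (hyp_measure \<mu> p \<psi>) UNIV"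
    and "hyp_integral \<mu> p \<psi> = emeasure (hyp_measure \<mu> p \<psi>) disk"
proof -
  show "hyp_integral \<mu> p \<psi> = emeasure (hyp_measure \<mu> p \<psi>) UNIV"
    using nn_integral_hyp_measure[OF \<mu> \<psi>, of "\<lambda>_. 1" p] by (simp add: hyp_integral_def)
  have "emeasure (hyp_measure \<mu> p \<psi>) disk = (\<integral>\<^sup>+ z. ennreal (hyp_deriv \<psi> z powr p) * indicator disk (\<psi> z) \<partial>\<mu>)"
    using nn_integral_hyp_measure[OF \<mu> \<psi>, of "indicator disk" p] by (simp add: borel_measurable_indicator)
  also have "\<dots> = hyp_integral \<mu> p \<psi>"
    unfolding hyp_integral_def using \<psi> space_disk_measure[OF \<mu>]
    by (intro nn_integral_cong) (force simp: self_map_def indicator_def)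
  finally show "hyp_integral \<mu> p \<psi> = emeasure (hyp_measure \<mu> p \<psi>) disk" ..
qed

text \<open>By the chain rule \<open>|(f \<circ> \<psi>)'|\<close> is the hyperbolic derivative of
  \<open>\<psi>\<close> times the Bloch weight \<open>(1 - |w|^2) * |f' w|\<close> at
  \<open>w = \<psi> z\<close>; a change of variables does the rest.\<close>

lemma deriv_integral_comp:
  assumes \<mu>: "sets \<mu> = sets (restrict_space borel disk)" and \<psi>: "self_map \<psi>"
    and f: "f holomorphic_on disk"
  shows "deriv_integral \<mu> p (f \<circ> \<psi>)
    = (\<integral>\<^sup>+ w. indicator disk w * ennreal (((1 - (cmod w)\<^sup>2) * cmod (deriv f w)) powr p) \<partial>hyp_measure \<mu> p \<psi>)"
proof -
  \<comment> \<open>Regularity of \<open>deriv f\<close> is known only inside the disk; the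
    indicator extends it to a Borel function on the plane.\<close>
  have [measurable]: "(\<lambda>w. indicator disk w *\<^sub>R deriv f w) \<in> borel_measurable borel"
    by (intro borel_measurable_continuous_on_indicator holomorphic_on_imp_continuous_on holomorphic_deriv f) auto
  have "(\<lambda>w. indicator disk w * ennreal (((1 - (cmod w)\<^sup>2) * cmod (indicator disk w *\<^sub>R deriv f w)) powr p))
      \<in> borel_measurable borel"
    by (intro borel_measurable_times_ennreal borel_measurable_indicator) (simp, measurable)
  also have "(\<lambda>w. indicator disk w * ennreal (((1 - (cmod w)\<^sup>2) * cmod (indicator disk w *\<^sub>R deriv f w)) powr p))
      = (\<lambda>w. indicator disk w * ennreal (((1 - (cmod w)\<^sup>2) * cmod (deriv f w)) powr p))"
    by (auto simp: indicator_def)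
  finally have meas: "(\<lambda>w. indicator disk w * ennreal (((1 - (cmod w)\<^sup>2) * cmod (deriv f w)) powr p))
      \<in> borel_measurable borel" .
  show ?thesis
    unfolding nn_integral_hyp_measure[OF \<mu> \<psi> meas] deriv_integral_def
  proof (intro nn_integral_cong)
    fix z assume "z \<in> space \<mu>"
    then have z: "z \<in> disk" using space_disk_measure[OF \<mu>] by simp
    then have \<psi>z: "\<psi> z \<in> disk" using \<psi> unfolding self_map_def by blast
    then have "(cmod (\<psi> z))\<^sup>2 < 1" by (simp add: power_less_one_iff)
    moreover have "deriv (f \<circ> \<psi>) z = deriv f (\<psi> z) * deriv \<psi> z"
      using \<psi> by (intro deriv_comp_disk[OF f _ _ z]) (auto simp: self_map_def)
    ultimately have "cmod (deriv (f \<circ> \<psi>) z) = hyp_deriv \<psi> z * ((1 - (cmod (\<psi> z))\<^sup>2) * cmod (deriv f (\<psi> z)))"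
      and "0 \<le> hyp_deriv \<psi> z" and "0 \<le> (1 - (cmod (\<psi> z))\<^sup>2) * cmod (deriv f (\<psi> z))"
      by (auto simp: hyp_deriv_def norm_mult)
    then show "ennreal (cmod (deriv (f \<circ> \<psi>) z) powr p) = ennreal (hyp_deriv \<psi> z powr p) *
        (indicator disk (\<psi> z) * ennreal (((1 - (cmod (\<psi> z))\<^sup>2) * cmod (deriv f (\<psi> z))) powr p))"
      using \<psi>z by (simp add: powr_mult ennreal_mult)
  qed
qed

text \<open>For splitting integrals: \<open>U\<close> is meant as a region near the unit circle,
  where the Bloch weight is merely bounded by \<open>B2\<close> but the mass is small, while off
  \<open>U\<close> the bound \<open>B1\<close> can be small and is charged to the full mass.\<close>

lemma deriv_integral_comp_le:
  assumes \<mu>: "sets \<mu> = sets (restrict_space borel disk)" and \<psi>: "self_map \<psi>"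
    and f: "f holomorphic_on disk" and p: "1 \<le> p" and U: "U \<in> sets borel"
    and B1: "\<And>w. w \<in> disk \<Longrightarrow> w \<notin> U \<Longrightarrow> (1 - (cmod w)\<^sup>2) * cmod (deriv f w) \<le> B1"
    and B2: "\<And>w. w \<in> disk \<Longrightarrow> w \<in> U \<Longrightarrow> (1 - (cmod w)\<^sup>2) * cmod (deriv f w) \<le> B2"
  shows "deriv_integral \<mu> p (f \<circ> \<psi>)
    \<le> ennreal (B1 powr p) * hyp_integral \<mu> p \<psi> + ennreal (B2 powr p) * emeasure (hyp_measure \<mu> p \<psi>) U"
proof -
  have "deriv_integral \<mu> p (f \<circ> \<psi>)
    \<le> (\<integral>\<^sup>+ w. ennreal (B1 powr p) * indicator UNIV w + ennreal (B2 powr p) * indicator U w \<partial>hyp_measure \<mu> p \<psi>)"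
    unfolding deriv_integral_comp[OF \<mu> \<psi> f]
  proof (rule nn_integral_mono)
    fix w :: complex
    define x where "x = (1 - (cmod w)\<^sup>2) * cmod (deriv f w)"
    show "indicator disk w * ennreal (((1 - (cmod w)\<^sup>2) * cmod (deriv f w)) powr p)
      \<le> ennreal (B1 powr p) * indicator UNIV w + ennreal (B2 powr p) * indicator U w"
    proof (cases "w \<in> disk")
      case True
      then have "0 \<le> x" by (auto simp: x_def power_le_one)
      then have "ennreal (x powr p) \<le> ennreal ((if w \<in> U then B2 else B1) powr p)"
        using B1[OF True] B2[OF True] p by (auto simp: x_def intro!: ennreal_leI powr_mono2)
      then show ?thesis
        using True by (auto simp: x_def indicator_def split: if_splits intro: order_trans add_increasing)
    qed simp
  qed
  also have "\<dots> = ennreal (B1 powr p) * emeasure (hyp_measure \<mu> p \<psi>) UNIV + ennreal (B2 powr p) * emeasure (hyp_measure \<mu> p \<psi>) U"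
    using U by (simp add: nn_integral_add nn_integral_cmult_indicator borel_measurable_times_ennreal
        borel_measurable_indicator measurable_cong_sets[OF sets_hyp_measure refl] del: indicator_UNIV)
  finally show ?thesis unfolding hyp_integral_eq(1)[OF \<mu> \<psi>] .
qed

text \<open>On the chosen annuli \<open>lacunary_deriv_lower\<close> bounds
  \<open>1 / (1 - |w|^2)\<close> by 400 times the derivative of the series, so the hyperbolic
  derivative of \<open>\<psi>\<close> is at most 400 times
  \<open>|(lacunary d \<circ> \<psi>)'|\<close>.\<close>

lemma hyp_measure_le_lacunary:
  assumes \<mu>: "sets \<mu> = sets (restrict_space borel disk)" and \<psi>: "self_map \<psi>" and p: "1 \<le> p"
    and d: "\<And>n. cmod (d n) \<le> 1" and gap: "\<And>n. even n \<noteq> \<pi> \<Longrightarrow> d n = 0"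
    and A: "\<And>m. m \<in> A \<Longrightarrow> cmod (d m) = 1"
  shows "emeasure (hyp_measure \<mu> p \<psi>) (\<Union>m\<in>A. annulus m)
    \<le> ennreal (400 powr p) * deriv_integral \<mu> p (lacunary d \<circ> \<psi>)"
proof -
  have hol: "lacunary d holomorphic_on disk"
    using lacunary_Bloch[of d, OF d] by (simp add: Bloch_def H_disk_def)
  let ?U = "\<Union>m\<in>A. annulus m"
  have "emeasure (hyp_measure \<mu> p \<psi>) ?U = (\<integral>\<^sup>+ w. indicator ?U w \<partial>hyp_measure \<mu> p \<psi>)"
    using UN_annulus_borel by simp
  also have "\<dots> = (\<integral>\<^sup>+ z. ennreal (hyp_deriv \<psi> z powr p) * indicator ?U (\<psi> z) \<partial>\<mu>)"
    using UN_annulus_borel by (intro nn_integral_hyp_measure[OF \<mu> \<psi>]) auto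
  also have "\<dots> \<le> (\<integral>\<^sup>+ z. ennreal (400 powr p) * ennreal (cmod (deriv (lacunary d \<circ> \<psi>) z) powr p) \<partial>\<mu>)"
  proof (rule nn_integral_mono)
    fix z assume "z \<in> space \<mu>"
    then have z: "z \<in> disk" using space_disk_measure[OF \<mu>] by simp
    show "ennreal (hyp_deriv \<psi> z powr p) * indicator ?U (\<psi> z)
      \<le> ennreal (400 powr p) * ennreal (cmod (deriv (lacunary d \<circ> \<psi>) z) powr p)"
    proof (cases "\<psi> z \<in> ?U")
      case True
      then obtain m where m: "m \<in> A" "\<psi> z \<in> annulus m" by blast
      \<comment> \<open>As \<open>d m\<close> is nonzero, \<open>m\<close> itself has the parity
        \<open>\<pi>\<close>.\<close>
      have gap': "\<And>n. even n \<noteq> even m \<Longrightarrow> d n = 0"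
        using gap A[OF m(1)] by (metis norm_zero zero_neq_one)
      have \<psi>z: "\<psi> z \<in> disk" using m annulus_subset_disk by blast
      then have "(cmod (\<psi> z))\<^sup>2 < 1" by (simp add: power_less_one_iff)
      moreover have "1 / (400 * (1 - (cmod (\<psi> z))\<^sup>2)) \<le> cmod (deriv (lacunary d) (\<psi> z))"
        by (rule lacunary_deriv_lower[of d m, OF d gap' A[OF m(1)] m(2)])
      ultimately have "1 / (1 - (cmod (\<psi> z))\<^sup>2) \<le> 400 * cmod (deriv (lacunary d) (\<psi> z))"
        by (simp add: field_simps)
      then have "cmod (deriv \<psi> z) * (1 / (1 - (cmod (\<psi> z))\<^sup>2))
          \<le> cmod (deriv \<psi> z) * (400 * cmod (deriv (lacunary d) (\<psi> z)))"
        by (intro mult_left_mono) auto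
      moreover have "deriv (lacunary d \<circ> \<psi>) z = deriv (lacunary d) (\<psi> z) * deriv \<psi> z"
        using \<psi> by (intro deriv_comp_disk[OF hol _ _ z]) (auto simp: self_map_def)
      ultimately have "hyp_deriv \<psi> z \<le> 400 * cmod (deriv (lacunary d \<circ> \<psi>) z)"
        by (simp add: hyp_deriv_def norm_mult ac_simps)
      moreover have "0 \<le> hyp_deriv \<psi> z"
        using \<open>(cmod (\<psi> z))\<^sup>2 < 1\<close> by (simp add: hyp_deriv_def)
      ultimately have "hyp_deriv \<psi> z powr p \<le> 400 powr p * cmod (deriv (lacunary d \<circ> \<psi>) z) powr p"
        using p powr_mono2[of p "hyp_deriv \<psi> z" "400 * cmod (deriv (lacunary d \<circ> \<psi>) z)"]
        by (simp add: powr_mult)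
      then show ?thesis using True by (simp flip: ennreal_mult)
    qed simp
  qed
  also have "\<dots> = ennreal (400 powr p) * deriv_integral \<mu> p (lacunary d \<circ> \<psi>)"
    unfolding deriv_integral_def using \<psi> hol
    by (intro nn_integral_cmult deriv_powr_measurable[OF \<mu>])
      (auto simp: self_map_def intro!: holomorphic_on_compose_gen[of _ _ _ disk])
  finally show ?thesis .
qed

section \<open>The composition operator on functions of the disk\<close>

lemma comp_op_H_disk:
  assumes "self_map \<phi>" "f \<in> H_disk"
  shows "comp_op \<phi> f \<in> H_disk"
proof -
  have "(f \<circ> \<phi>) holomorphic_on disk" by (rule H_disk_comp_holomorphic[OF assms(2,1)])
  then have "comp_op \<phi> f holomorphic_on disk"
    by (rule holomorphic_transform) (simp add: comp_op_def)
  then show ?thesis by (simp add: H_disk_def comp_op_def)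
qed

lemma deriv_integral_comp_op:
  assumes \<mu>: "sets \<mu> = sets (restrict_space borel disk)" and \<sigma>: "\<sigma> \<in> Aut_disk"
  shows "deriv_integral \<mu> p (comp_op \<phi> f \<circ> \<sigma>) = deriv_integral \<mu> p (f \<circ> (\<phi> \<circ> \<sigma>))"
  unfolding deriv_integral_def
proof (rule nn_integral_cong)
  fix z assume "z \<in> space \<mu>"
  then have z: "z \<in> disk" using space_disk_measure[OF \<mu>] by simp
  \<comment> \<open>The cut-off in \<open>comp_op\<close> is invisible near \<open>z\<close>, since
    \<open>\<sigma>\<close> maps the open disk into itself; so the derivatives agree.\<close>
  have "\<forall>\<^sub>F y in nhds z. (comp_op \<phi> f \<circ> \<sigma>) y = (f \<circ> (\<phi> \<circ> \<sigma>)) y"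
    using Aut_diskD(2)[OF \<sigma>] by (intro eventually_nhds_in_open[OF open_ball z, THEN eventually_mono])
      (auto simp: comp_op_def)
  then show "ennreal (cmod (deriv (comp_op \<phi> f \<circ> \<sigma>) z) powr p) = ennreal (cmod (deriv (f \<circ> (\<phi> \<circ> \<sigma>)) z) powr p)"
    by (simp only: deriv_cong_ev[OF _ refl])
qed

section \<open>Normal families in the Bloch space\<close>

lemma Bloch_le_norm:
  assumes "f \<in> Bloch" "z \<in> disk"
  shows "cmod (f 0) + (1 - (cmod z)\<^sup>2) * cmod (deriv f z) \<le> Bloch_norm f"
  unfolding Bloch_norm_def using assms by (intro add_left_mono cSUP_upper) (auto simp: Bloch_def)

lemma BlochI:
  assumes "f \<in> H_disk" "\<And>z. z \<in> disk \<Longrightarrow> cmod (f 0) + (1 - (cmod z)\<^sup>2) * cmod (deriv f z) \<le> b"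
  shows "f \<in> Bloch" "Bloch_norm f \<le> b"
proof -
  have le: "(1 - (cmod z)\<^sup>2) * cmod (deriv f z) \<le> b - cmod (f 0)" if "z \<in> disk" for z
    using assms(2)[OF that] by linarith
  then show "f \<in> Bloch" using assms(1) by (auto simp: Bloch_def intro!: bdd_aboveI)
  have "(SUP z\<in>disk. (1 - (cmod z)\<^sup>2) * cmod (deriv f z)) \<le> b - cmod (f 0)"
    using le by (intro cSUP_least) auto
  then show "Bloch_norm f \<le> b" by (simp add: Bloch_norm_def)
qed

lemma Bloch_norm_nonneg:
  assumes "f \<in> Bloch"
  shows "0 \<le> Bloch_norm f"
  using Bloch_le_norm[OF assms, of 0] by (simp add: add_nonneg_nonneg order_trans[rotated])

lemma Bloch_cmult:
  assumes "f \<in> Bloch"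
  shows "(\<lambda>z. c * f z) \<in> Bloch" "Bloch_norm (\<lambda>z. c * f z) \<le> cmod c * Bloch_norm f"
proof -
  have H: "f holomorphic_on disk" "\<And>z. z \<notin> disk \<Longrightarrow> f z = 0"
    using assms by (auto simp: Bloch_def H_disk_def)
  have "(\<lambda>z. c * f z) \<in> H_disk"
    using H by (auto simp: H_disk_def intro!: holomorphic_intros)
  moreover have "cmod (c * f 0) + (1 - (cmod z)\<^sup>2) * cmod (deriv (\<lambda>z. c * f z) z) \<le> cmod c * Bloch_norm f"
    if z: "z \<in> disk" for z
  proof -
    have "deriv (\<lambda>z. c * f z) z = c * deriv f z"
      using H(1) z by (intro deriv_cmult holomorphic_on_imp_differentiable_at[OF _ open_ball])
    then have "cmod (c * f 0) + (1 - (cmod z)\<^sup>2) * cmod (deriv (\<lambda>z. c * f z) z)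
        = cmod c * (cmod (f 0) + (1 - (cmod z)\<^sup>2) * cmod (deriv f z))"
      by (simp add: norm_mult algebra_simps)
    also have "\<dots> \<le> cmod c * Bloch_norm f"
      by (intro mult_left_mono Bloch_le_norm assms z) auto
    finally show ?thesis .
  qed
  ultimately show "(\<lambda>z. c * f z) \<in> Bloch" "Bloch_norm (\<lambda>z. c * f z) \<le> cmod c * Bloch_norm f"
    using BlochI by blast+
qed

lemma Bloch_deriv_le:
  assumes "f \<in> Bloch" "cmod z \<le> r" "r < 1"
  shows "cmod (deriv f z) \<le> Bloch_norm f / (1 - r\<^sup>2)"
proof -
  have r: "0 \<le> r" using assms(2) norm_ge_zero order_trans by blast
  have "0 < 1 - r\<^sup>2" using r assms(3) by (simp add: power_less_one_iff)
  moreover have "(1 - r\<^sup>2) * cmod (deriv f z) \<le> (1 - (cmod z)\<^sup>2) * cmod (deriv f z)"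
    using assms(2) by (intro mult_right_mono) (auto intro: power_mono)
  moreover have "(1 - (cmod z)\<^sup>2) * cmod (deriv f z) \<le> Bloch_norm f"
    using Bloch_le_norm[OF assms(1), of z] assms(2,3) norm_ge_zero[of "f 0"]
    by (simp del: norm_ge_zero)
  ultimately show ?thesis by (simp add: field_simps)
qed

text \<open>The derivative bound on \<open>cball 0 r\<close> is integrated from 0 by the mean value
  inequality. This is the local boundedness that Montel's theorem requires.\<close>

lemma Bloch_bound:
  assumes "f \<in> Bloch" "cmod z \<le> r" "r < 1"
  shows "cmod (f z) \<le> Bloch_norm f + Bloch_norm f / (1 - r\<^sup>2)"
proof -
  have hol: "f holomorphic_on disk" using assms by (auto simp: Bloch_def H_disk_def)
  have r: "0 \<le> r" using assms(2) norm_ge_zero order_trans by blast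
  define B where "B = Bloch_norm f / (1 - r\<^sup>2)"
  have "0 \<le> 1 - r\<^sup>2" using r assms(3) by (simp add: power_le_one)
  then have B: "0 \<le> B" using Bloch_norm_nonneg[OF assms(1)] by (simp add: B_def)
  have "norm (f z - f 0) \<le> B * norm (z - 0)"
  proof (rule field_differentiable_bound[of "cball 0 r" f "deriv f"])
    fix w assume "w \<in> cball (0::complex) r"
    then have w: "cmod w \<le> r" "w \<in> disk" using assms(3) by auto
    show "(f has_field_derivative deriv f w) (at w within cball 0 r)"
      using holomorphic_derivI[OF hol open_ball w(2)] .
    show "cmod (deriv f w) \<le> B"
      unfolding B_def by (rule Bloch_deriv_le[OF assms(1) w(1) assms(3)])
  qed (use assms r in auto)
  also have "B * norm (z - 0) \<le> B * 1"
    using assms B by (intro mult_left_mono) auto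
  finally have "cmod (f z) \<le> cmod (f 0) + B"
    using norm_triangle_sub[of "f z" "f 0"] by linarith
  moreover have "cmod (f 0) \<le> Bloch_norm f"
    using Bloch_le_norm[OF assms(1), of 0] norm_ge_zero[of "deriv f 0"]
    by (simp del: norm_ge_zero)
  ultimately show ?thesis by (simp add: B_def)
qed

lemma compact_subset_disk:
  assumes "compact K" "K \<subseteq> disk"
  obtains r where "r < 1" "\<And>z. z \<in> K \<Longrightarrow> cmod z \<le> r"
proof (cases "K = {}")
  case False
  then obtain x where "x \<in> K" "\<And>z. z \<in> K \<Longrightarrow> cmod z \<le> cmod x"
    using continuous_attains_sup[of K cmod] assms(1) continuous_on_norm_id by blast
  then show ?thesis using that[of "cmod x"] assms(2) by auto
qed (use that[of 0] in auto)

lemma uniform_limit_imp_deriv: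
  assumes hol: "\<And>n. f n holomorphic_on disk" "g holomorphic_on disk"
    and lim: "\<And>K. compact K \<Longrightarrow> K \<subseteq> disk \<Longrightarrow> uniform_limit K f g sequentially"
    and "R < 1" "0 < \<epsilon>"
  shows "\<forall>\<^sub>F n in sequentially. \<forall>w\<in>cball 0 R. cmod (deriv (f n) w - deriv g w) \<le> \<epsilon>"
proof -
  \<comment> \<open>Circles of radius \<open>r\<close> around points of \<open>cball 0 R\<close>
    stay in \<open>cball 0 (R + r)\<close>, a compact part of the disk.\<close>
  define r where "r = (1 - R) / 2"
  have r: "0 < r" "R + r < 1" using \<open>R < 1\<close> by (simp_all add: r_def field_simps)
  have "uniform_limit (cball 0 (R + r)) f g sequentially"
    using r by (intro lim) auto
  \<comment> \<open>The factor \<open>r\<close> cancels the \<open>1 / r\<close> of the Cauchy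
    estimate for the first derivative.\<close>
  then have "\<forall>\<^sub>F n in sequentially. \<forall>x\<in>cball 0 (R + r). dist (f n x) (g x) < \<epsilon> * r"
    using \<open>0 < \<epsilon>\<close> r by (auto simp: uniform_limit_iff)
  then show ?thesis
  proof eventually_elim
    case (elim n)
    show ?case
    proof
      fix w :: complex assume w: "w \<in> cball 0 R"
      have sub: "cball w r \<subseteq> cball 0 (R + r)"
      proof
        fix x assume "x \<in> cball w r"
        moreover have "dist 0 x \<le> dist 0 w + dist w x" by (rule dist_triangle)
        ultimately show "x \<in> cball 0 (R + r)" using w by auto
      qed
      have sub': "cball 0 (R + r) \<subseteq> disk" using r by auto
      have hd: "(\<lambda>z. f n z - g z) holomorphic_on disk"
        by (intro holomorphic_intros hol)
      have "norm ((deriv ^^ 1) (\<lambda>z. f n z - g z) w) \<le> fact 1 * (\<epsilon> * r) / r ^ 1"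
      proof (rule Cauchy_inequality)
        show "(\<lambda>z. f n z - g z) holomorphic_on ball w r"
          using sub sub' by (intro holomorphic_on_subset[OF hd]) (meson ball_subset_cball order_trans)
        show "continuous_on (cball w r) (\<lambda>z. f n z - g z)"
          using sub sub' by (intro continuous_on_subset[OF holomorphic_on_imp_continuous_on[OF hd]]) auto
        fix x assume "cmod (w - x) = r"
        then have "x \<in> cball w r" by (simp add: dist_norm)
        then have "dist (f n x) (g x) < \<epsilon> * r" using elim sub by blast
        then show "cmod (f n x - g x) \<le> \<epsilon> * r" by (simp add: dist_norm)
      qed (use r in auto)
      moreover have "w \<in> disk" using w \<open>R < 1\<close> by auto
      then have "deriv (\<lambda>z. f n z - g z) w = deriv (f n) w - deriv g w"
        by (intro deriv_diff holomorphic_on_imp_differentiable_at[OF hol(1) open_ball]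
            holomorphic_on_imp_differentiable_at[OF hol(2) open_ball])
      ultimately show "cmod (deriv (f n) w - deriv g w) \<le> \<epsilon>"
        using r by simp
    qed
  qed
qed

text \<open>Montel's theorem yields a locally uniform limit, and derivatives converge along with the
  functions. The Bloch inequality at each fixed point survives the limit, so \<open>g\<close> stays
  in the unit ball.\<close>

lemma Bloch_ball_normal:
  fixes f :: "nat \<Rightarrow> complex \<Rightarrow> complex"
  assumes f: "\<And>n. f n \<in> Bloch" "\<And>n. Bloch_norm (f n) \<le> 1"
  obtains g r where "g \<in> Bloch" "Bloch_norm g \<le> 1" "strict_mono r"
    "\<And>z. z \<in> disk \<Longrightarrow> (\<lambda>n. f (r n) z) \<longlonglongrightarrow> g z"
    "\<And>R \<epsilon>. R < 1 \<Longrightarrow> 0 < \<epsilon> \<Longrightarrow>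
      \<forall>\<^sub>F n in sequentially. \<forall>w\<in>cball 0 R. cmod (deriv (f (r n)) w - deriv g w) \<le> \<epsilon>"
proof -
  define F where "F = {h \<in> Bloch. Bloch_norm h \<le> 1}"
  have hol: "h holomorphic_on disk" if "h \<in> F" for h
    using that by (auto simp: F_def Bloch_def H_disk_def)
  have bdd: "\<exists>B. \<forall>h\<in>F. \<forall>z\<in>K. cmod (h z) \<le> B" if K: "compact K" "K \<subseteq> disk" for K
  proof -
    obtain r where r: "r < 1" "\<And>z. z \<in> K \<Longrightarrow> cmod z \<le> r"
      using compact_subset_disk[OF K] by blast
    have "cmod (h z) \<le> 1 + 1 / (1 - r\<^sup>2)" if "h \<in> F" "z \<in> K" for h z
    proof -
      have "0 \<le> r" using r(2)[OF that(2)] norm_ge_zero order_trans by blast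
      then have "0 \<le> 1 - r\<^sup>2" using r(1) by (simp add: power_le_one)
      then have "Bloch_norm h + Bloch_norm h / (1 - r\<^sup>2) \<le> 1 + 1 / (1 - r\<^sup>2)"
        using that(1) by (intro add_mono divide_right_mono) (auto simp: F_def)
      then show ?thesis
        using Bloch_bound[of h z r] r that by (auto simp: F_def)
    qed
    then show ?thesis by blast
  qed
  have rng: "range f \<subseteq> F" using f by (auto simp: F_def)
  obtain g0 r where g0: "g0 holomorphic_on disk" and r: "strict_mono (r :: nat \<Rightarrow> nat)"
    and pt0: "\<And>x. x \<in> disk \<Longrightarrow> (\<lambda>n. f (r n) x) \<longlonglongrightarrow> g0 x"
    and ul0: "\<And>K. compact K \<Longrightarrow> K \<subseteq> disk \<Longrightarrow> uniform_limit K (f \<circ> r) g0 sequentially"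
    using Montel[OF open_ball hol bdd rng] by blast
  \<comment> \<open>The values of \<open>g0\<close> outside the disk are arbitrary, whereas members
    of \<open>H_disk\<close> vanish there.\<close>
  define g where "g z = (if z \<in> disk then g0 z else 0)" for z
  have gh: "g holomorphic_on disk"
    by (rule holomorphic_transform[OF g0]) (simp add: g_def)
  have pt: "(\<lambda>n. f (r n) z) \<longlonglongrightarrow> g z" if "z \<in> disk" for z
    using pt0[OF that] that by (simp add: g_def)
  have ul: "uniform_limit K (\<lambda>n. f (r n)) g sequentially" if "compact K" "K \<subseteq> disk" for K
    using ul0[OF that] that(2) by (subst uniform_limit_cong'[where g = "f \<circ> r" and i = g0]) (auto simp: g_def o_def)
  have dl: "\<forall>\<^sub>F n in sequentially. \<forall>w\<in>cball 0 R. cmod (deriv (f (r n)) w - deriv g w) \<le> \<epsilon>"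
    if "R < 1" "0 < \<epsilon>" for R \<epsilon>
    using rng by (intro uniform_limit_imp_deriv[OF _ gh ul that] hol) auto
  have "cmod (g 0) + (1 - (cmod z)\<^sup>2) * cmod (deriv g z) \<le> 1" if z: "z \<in> disk" for z
  proof -
    have "(\<lambda>n. deriv (f (r n)) z) \<longlonglongrightarrow> deriv g z"
    proof (rule tendstoI)
      fix e :: real assume "0 < e"
      then have "\<forall>\<^sub>F n in sequentially. \<forall>w\<in>cball 0 (cmod z). cmod (deriv (f (r n)) w - deriv g w) \<le> e / 2"
        using z by (intro dl) auto
      then show "\<forall>\<^sub>F n in sequentially. dist (deriv (f (r n)) z) (deriv g z) < e"
        by eventually_elim (use \<open>0 < e\<close> in \<open>force simp: dist_norm\<close>)
    qed
    then have "(\<lambda>n. cmod (f (r n) 0) + (1 - (cmod z)\<^sup>2) * cmod (deriv (f (r n)) z))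
        \<longlonglongrightarrow> cmod (g 0) + (1 - (cmod z)\<^sup>2) * cmod (deriv g z)"
      by (intro tendsto_intros pt) auto
    moreover have "cmod (f (r n) 0) + (1 - (cmod z)\<^sup>2) * cmod (deriv (f (r n)) z) \<le> 1" for n
      using Bloch_le_norm[OF f(1) z, of "r n"] f(2)[of "r n"] by linarith
    ultimately show ?thesis by (intro Lim_bounded[where M = 0]) auto
  qed
  moreover have "g \<in> H_disk" using gh by (auto simp: H_disk_def g_def)
  ultimately have "g \<in> Bloch" "Bloch_norm g \<le> 1" using BlochI by blast+
  with r pt dl show ?thesis by (intro that)
qed

section \<open>Linearity, and boundedness of compact operators\<close>

lemma comp_op_linear:
  assumes "comp_op \<phi> ` V \<subseteq> W"
  shows "linear_operator V W (comp_op \<phi>)"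
  using assms by (auto simp: linear_operator_def comp_op_def)

text \<open>A compact closure makes the image of the unit ball metrically bounded; homogeneity
  extends the bound to all of \<open>Bloch\<close>.\<close>

lemma compact_imp_bounded_operator:
  assumes \<mu>: "sets \<mu> = sets (restrict_space borel disk)" and p: "1 \<le> p" and ax: "standing_axiom \<mu> p"
    and T: "compact_operator Bloch Bloch_norm (M0_space \<mu> p) (M_norm \<mu> p) T"
  shows "bounded_operator Bloch Bloch_norm (M0_space \<mu> p) (M_norm \<mu> p) T"
proof -
  have V: "normed_fun_space (M0_space \<mu> p) (M_norm \<mu> p)" by (rule normed_fun_space_M0[OF \<mu> p ax])
  interpret Metric_space "M0_space \<mu> p" "fun_dist (M0_space \<mu> p) (M_norm \<mu> p)"
    by (rule Metric_space_fun_dist[OF V])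
  let ?X = "T ` {f \<in> Bloch. Bloch_norm f \<le> 1}"
  have lin: "linear_operator Bloch (M0_space \<mu> p) T"
    and cpt: "compactin mtopology (mtopology closure_of ?X)"
    using T by (auto simp: compact_operator_def)
  have X: "?X \<subseteq> M0_space \<mu> p" using lin by (auto simp: linear_operator_def)
  have "mbounded ?X"
    using compactin_imp_mbounded[OF cpt] closure_of_subset[of ?X mtopology] X
    by (auto intro: mbounded_subset)
  then obtain c B where "?X \<subseteq> mcball c B" by (auto simp: mbounded_def)
  have z: "(\<lambda>_. 0) \<in> M0_space \<mu> p" using V by (simp add: normed_fun_space_def)
  have "\<exists>B. \<forall>h\<in>?X. M_norm \<mu> p h \<le> B"
  proof (intro exI ballI)
    fix h assume h: "h \<in> ?X"
    then have hM: "h \<in> M0_space \<mu> p" "c \<in> M0_space \<mu> p"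
      and hc: "fun_dist (M0_space \<mu> p) (M_norm \<mu> p) c h \<le> B"
      using X \<open>?X \<subseteq> mcball c B\<close> by auto
    \<comment> \<open>The bounding ball has some centre \<open>c\<close>; a bound on norms needs the
      centre 0.\<close>
    have "fun_dist (M0_space \<mu> p) (M_norm \<mu> p) h (\<lambda>_. 0)
      \<le> fun_dist (M0_space \<mu> p) (M_norm \<mu> p) h c + fun_dist (M0_space \<mu> p) (M_norm \<mu> p) c (\<lambda>_. 0)"
      using hM z by (intro triangle)
    then show "M_norm \<mu> p h \<le> B + fun_dist (M0_space \<mu> p) (M_norm \<mu> p) c (\<lambda>_. 0)"
      using hc hM z commute[of h c] by (simp add: fun_dist_def)
  qed
  then obtain C where C: "\<And>f. f \<in> Bloch \<Longrightarrow> Bloch_norm f \<le> 1 \<Longrightarrow> M_norm \<mu> p (T f) \<le> C"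
    by blast
  have "M_norm \<mu> p (T f) \<le> C * Bloch_norm f" if f: "f \<in> Bloch" for f
  proof -
    \<comment> \<open>Scaling by \<open>1 / t\<close> with \<open>t\<close> above the norm of
      \<open>f\<close>, and letting \<open>t\<close> decrease to it, also covers the case of norm
      0.\<close>
    have lim: "((\<lambda>t. C * t) \<longlongrightarrow> C * Bloch_norm f) (at_right (Bloch_norm f))"
      by (intro tendsto_intros)
    have le: "M_norm \<mu> p (T f) \<le> C * t" if t: "Bloch_norm f < t" for t
    proof -
      have t0: "0 < t" using Bloch_norm_nonneg[OF f] t by linarith
      let ?c = "complex_of_real (1 / t)"
      have "Bloch_norm (\<lambda>z. ?c * f z) \<le> cmod ?c * Bloch_norm f" by (rule Bloch_cmult(2)[OF f])
      also have "\<dots> \<le> 1" using t t0 by (simp add: norm_divide)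
      finally have "M_norm \<mu> p (T (\<lambda>z. ?c * f z)) \<le> C"
        by (intro C Bloch_cmult(1) f)
      moreover have "T (\<lambda>z. ?c * f z) = (\<lambda>z. ?c * T f z)"
        using lin f unfolding linear_operator_def by blast
      moreover have "M_norm \<mu> p (\<lambda>z. ?c * T f z) = cmod ?c * M_norm \<mu> p (T f)"
        using lin f by (intro normed_fun_spaceD(4)[OF V]) (auto simp: linear_operator_def)
      ultimately have "cmod ?c * M_norm \<mu> p (T f) \<le> C" by (simp only:)
      then show ?thesis using t0 by (simp add: norm_divide field_simps)
    qed
    show ?thesis
      by (rule tendsto_lowerbound[OF lim])
        (use le in \<open>auto simp: eventually_at_right_field intro: exI[of _ "Bloch_norm f + 1"]\<close>)
  qed
  then show ?thesis using lin by (auto simp: bounded_operator_def)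
qed

section \<open>Composition operators into the little space\<close>

context
  fixes p :: real and \<mu> :: "complex measure" and \<phi> :: "complex \<Rightarrow> complex"
  assumes p: "1 \<le> p" and \<mu>: "sets \<mu> = sets (restrict_space borel disk)"
    and ax: "standing_axiom \<mu> p" and \<phi>: "self_map \<phi>"
begin

section \<open>The hyperbolic conditions and the mapping property\<close>

lemma hyp_conditions_imp_comp_op_M0:
  assumes lim: "((\<lambda>\<sigma>. hyp_integral \<mu> p (\<phi> \<circ> \<sigma>)) \<longlongrightarrow> 0) aut_boundary"
    and sup: "(SUP \<sigma>\<in>Aut_disk. hyp_integral \<mu> p (\<phi> \<circ> \<sigma>)) < \<infinity>"
    and f: "f \<in> Bloch"
  shows "comp_op \<phi> f \<in> M0_space \<mu> p"
proof -
  define S where "S = (SUP \<sigma>\<in>Aut_disk. hyp_integral \<mu> p (\<phi> \<circ> \<sigma>))"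
  define B where "B = ennreal (Bloch_norm f powr p)"
  have H: "f \<in> H_disk" and hol: "f holomorphic_on disk" using f by (auto simp: Bloch_def H_disk_def)
  have le: "deriv_integral \<mu> p (comp_op \<phi> f \<circ> \<sigma>) \<le> B * hyp_integral \<mu> p (\<phi> \<circ> \<sigma>)" if \<sigma>: "\<sigma> \<in> Aut_disk" for \<sigma>
  proof -
    have b: "(1 - (cmod w)\<^sup>2) * cmod (deriv f w) \<le> Bloch_norm f" if "w \<in> disk" for w
      using Bloch_le_norm[OF f that] norm_ge_zero[of "f 0"] by linarith
    \<comment> \<open>With \<open>U\<close> empty the estimate is the Bloch bound alone, so both
      defining properties of \<open>M0_space\<close> are inherited from the hyperbolic
      integrals.\<close>
    show ?thesis
      using deriv_integral_comp_le[OF \<mu> self_map_comp_Aut[OF \<phi> \<sigma>] hol p, of "{}" "Bloch_norm f" 0] b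
      by (simp add: deriv_integral_comp_op[OF \<mu> \<sigma>] B_def)
  qed
  have "(SUP \<sigma>\<in>Aut_disk. deriv_integral \<mu> p (comp_op \<phi> f \<circ> \<sigma>)) \<le> B * S"
    unfolding S_def by (intro SUP_least order_trans[OF le] mult_left_mono SUP_upper) auto
  also have "\<dots> < \<infinity>" using sup by (simp add: B_def S_def ennreal_mult_less_top)
  finally have "comp_op \<phi> f \<in> M_space \<mu> p"
    using comp_op_H_disk[OF \<phi> H] by (simp add: M_space_def)
  moreover have "((\<lambda>\<sigma>. deriv_integral \<mu> p (comp_op \<phi> f \<circ> \<sigma>)) \<longlongrightarrow> 0) aut_boundary"
  proof (rule tendsto_sandwich[where f = "\<lambda>_. 0" and h = "\<lambda>\<sigma>. B * hyp_integral \<mu> p (\<phi> \<circ> \<sigma>)"])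
    show "((\<lambda>\<sigma>. B * hyp_integral \<mu> p (\<phi> \<circ> \<sigma>)) \<longlongrightarrow> 0) aut_boundary"
      using ennreal_tendsto_cmult[OF _ lim, of B] by (simp add: B_def)
    show "\<forall>\<^sub>F \<sigma> in aut_boundary. deriv_integral \<mu> p (comp_op \<phi> f \<circ> \<sigma>) \<le> B * hyp_integral \<mu> p (\<phi> \<circ> \<sigma>)"
      using le by (auto simp: eventually_aut_boundary intro!: exI[of _ 0])
  qed auto
  ultimately show ?thesis by (simp add: M0_space_def)
qed

lemma comp_op_M0_imp_hyp_conditions:
  assumes T: "comp_op \<phi> ` Bloch \<subseteq> M0_space \<mu> p"
  shows "((\<lambda>\<sigma>. hyp_integral \<mu> p (\<phi> \<circ> \<sigma>)) \<longlongrightarrow> 0) aut_boundary"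
    and "(SUP \<sigma>\<in>Aut_disk. hyp_integral \<mu> p (\<phi> \<circ> \<sigma>)) < \<infinity>"
proof -
  define d :: "bool \<Rightarrow> nat \<Rightarrow> complex" where "d \<pi> n = (if even n = \<pi> then 1 else 0)" for \<pi> n
  define I where "I \<pi> \<sigma> = deriv_integral \<mu> p (comp_op \<phi> (lacunary (d \<pi>)) \<circ> \<sigma>)" for \<pi> \<sigma>
  define C where "C = ennreal (400 powr p)"
  have d: "cmod (d \<pi> n) \<le> 1" for \<pi> n by (simp add: d_def)
  have "comp_op \<phi> (lacunary (d \<pi>)) \<in> M0_space \<mu> p" for \<pi>
    using T lacunary_Bloch[of "d \<pi>", OF d] by blast
  then have I: "(I \<pi> \<longlongrightarrow> 0) aut_boundary" "(SUP \<sigma>\<in>Aut_disk. I \<pi> \<sigma>) < \<infinity>" for \<pi>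
    by (auto simp: M0_space_def M_space_def I_def[abs_def])
  have le: "hyp_integral \<mu> p (\<phi> \<circ> \<sigma>) \<le> C * I True \<sigma> + C * I False \<sigma>" if \<sigma>: "\<sigma> \<in> Aut_disk" for \<sigma>
  proof -
    let ?\<psi> = "\<phi> \<circ> \<sigma>" and ?U = "\<lambda>\<pi>. \<Union>m\<in>{m. even m = \<pi>}. annulus m"
    have \<psi>: "self_map ?\<psi>" by (rule self_map_comp_Aut[OF \<phi> \<sigma>])
    have U: "emeasure (hyp_measure \<mu> p ?\<psi>) (?U \<pi>) \<le> C * I \<pi> \<sigma>" for \<pi>
      unfolding C_def I_def deriv_integral_comp_op[OF \<mu> \<sigma>]
      by (rule hyp_measure_le_lacunary[of \<mu> ?\<psi> p "d \<pi>" \<pi>, OF \<mu> \<psi> p d]) (auto simp: d_def)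
    \<comment> \<open>One series only controls annuli of its own parity; the two together reach
      every point.\<close>
    have "disk \<subseteq> ?U True \<union> ?U False"
    proof
      fix w assume "w \<in> disk"
      then obtain m where "w \<in> annulus m" using ex_annulus[of w 0] by auto
      then show "w \<in> ?U True \<union> ?U False" by (cases "even m") blast+
    qed
    then have "emeasure (hyp_measure \<mu> p ?\<psi>) disk \<le> emeasure (hyp_measure \<mu> p ?\<psi>) (?U True \<union> ?U False)"
      using UN_annulus_borel by (intro emeasure_mono) auto
    also have "\<dots> \<le> emeasure (hyp_measure \<mu> p ?\<psi>) (?U True) + emeasure (hyp_measure \<mu> p ?\<psi>) (?U False)"
      using UN_annulus_borel by (intro emeasure_subadditive) auto
    also have "\<dots> \<le> C * I True \<sigma> + C * I False \<sigma>" by (intro add_mono U)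
    finally show ?thesis by (simp add: hyp_integral_eq(2)[OF \<mu> \<psi>])
  qed
  show "((\<lambda>\<sigma>. hyp_integral \<mu> p (\<phi> \<circ> \<sigma>)) \<longlongrightarrow> 0) aut_boundary"
  proof (rule tendsto_sandwich[where f = "\<lambda>_. 0" and h = "\<lambda>\<sigma>. C * I True \<sigma> + C * I False \<sigma>"])
    show "((\<lambda>\<sigma>. C * I True \<sigma> + C * I False \<sigma>) \<longlongrightarrow> 0) aut_boundary"
      using tendsto_add[OF ennreal_tendsto_cmult[OF _ I(1), of C] ennreal_tendsto_cmult[OF _ I(1), of C], of True False]
      by (simp add: C_def)
    show "\<forall>\<^sub>F \<sigma> in aut_boundary. hyp_integral \<mu> p (\<phi> \<circ> \<sigma>) \<le> C * I True \<sigma> + C * I False \<sigma>"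
      using le by (auto simp: eventually_aut_boundary intro!: exI[of _ 0])
  qed auto
  have "(SUP \<sigma>\<in>Aut_disk. hyp_integral \<mu> p (\<phi> \<circ> \<sigma>))
      \<le> C * (SUP \<sigma>\<in>Aut_disk. I True \<sigma>) + C * (SUP \<sigma>\<in>Aut_disk. I False \<sigma>)"
    by (intro SUP_least order_trans[OF le] add_mono mult_left_mono SUP_upper) auto
  also have "\<dots> < \<infinity>" using I(2) by (simp add: C_def ennreal_mult_less_top)
  finally show "(SUP \<sigma>\<in>Aut_disk. hyp_integral \<mu> p (\<phi> \<circ> \<sigma>)) < \<infinity>" .
qed

section \<open>Uniformly small tails from separability\<close>

text \<open>With the parity fixed, differences of two of the test series are again gapped with
  coefficients of modulus at most 1, so \<open>hyp_measure_le_lacunary\<close> bounds their distance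
  from below.\<close>

lemma hyp_measure_parity_tail_small:
  assumes sep: "separable_space (norm_topology (M0_space \<mu> p) (M_norm \<mu> p))"
    and T: "comp_op \<phi> ` Bloch \<subseteq> M0_space \<mu> p" and \<epsilon>: "0 < \<epsilon>"
  shows "\<exists>M. \<forall>\<sigma>\<in>Aut_disk.
    emeasure (hyp_measure \<mu> p (\<phi> \<circ> \<sigma>)) (\<Union>m\<in>{m. M \<le> m \<and> even m = \<pi>}. annulus m) \<le> ennreal \<epsilon>"
proof (rule ccontr)
  assume "\<not> ?thesis"
  then have ex: "\<exists>\<sigma>\<in>Aut_disk. ennreal \<epsilon> <
      emeasure (hyp_measure \<mu> p (\<phi> \<circ> \<sigma>)) (\<Union>m\<in>{m. M \<le> m \<and> even m = \<pi>}. annulus m)" for M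
    by (meson not_le)
  define block where "block M N = {m. M \<le> m \<and> m < N \<and> even m = \<pi>}" for M N :: nat
  have "\<exists>\<sigma> N. \<sigma> \<in> Aut_disk \<and> M < N \<and>
      ennreal \<epsilon> < emeasure (hyp_measure \<mu> p (\<phi> \<circ> \<sigma>)) (\<Union>m\<in>block M N. annulus m)" for M
  proof -
    obtain \<sigma> where \<sigma>: "\<sigma> \<in> Aut_disk" and big: "ennreal \<epsilon> <
        emeasure (hyp_measure \<mu> p (\<phi> \<circ> \<sigma>)) (\<Union>m\<in>{m. M \<le> m \<and> even m = \<pi>}. annulus m)"
      using ex by blast
    \<comment> \<open>Continuity from below: a tail of mass greater than \<open>\<epsilon>\<close>
      contains a finite block with this property, and finite blocks can be made disjoint.\<close>
    have "(\<Union>N. \<Union>m\<in>block M N. annulus m) = (\<Union>m\<in>{m. M \<le> m \<and> even m = \<pi>}. annulus m)"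
      unfolding block_def by (auto intro: lessI)
    moreover have "incseq (\<lambda>N. \<Union>m\<in>block M N. annulus m)"
      unfolding incseq_def block_def by (intro allI impI UN_mono) auto
    then have "(SUP N. emeasure (hyp_measure \<mu> p (\<phi> \<circ> \<sigma>)) (\<Union>m\<in>block M N. annulus m))
        = emeasure (hyp_measure \<mu> p (\<phi> \<circ> \<sigma>)) (\<Union>N. \<Union>m\<in>block M N. annulus m)"
      using UN_annulus_borel by (intro SUP_emeasure_incseq) auto
    ultimately have "ennreal \<epsilon> < (SUP N. emeasure (hyp_measure \<mu> p (\<phi> \<circ> \<sigma>)) (\<Union>m\<in>block M N. annulus m))"
      using big by simp
    then obtain N where N:
        "ennreal \<epsilon> < emeasure (hyp_measure \<mu> p (\<phi> \<circ> \<sigma>)) (\<Union>m\<in>block M N. annulus m)"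
      unfolding less_SUP_iff by blast
    have "M < N"
    proof (rule ccontr)
      assume "\<not> M < N"
      then have "block M N = {}" by (auto simp: block_def)
      then show False using N by simp
    qed
    with \<sigma> N show ?thesis by blast
  qed
  then obtain s N where s: "\<And>M. s M \<in> Aut_disk" and N: "\<And>M. M < N M"
    and big: "\<And>M. ennreal \<epsilon> < emeasure (hyp_measure \<mu> p (\<phi> \<circ> s M)) (\<Union>m\<in>block M (N M). annulus m)"
    by metis
  \<comment> \<open>Iterating \<open>N\<close> lets each block begin where the previous one
    ends.\<close>
  define M where "M j = (N ^^ j) 0" for j
  have M_Suc: "M (Suc j) = N (M j)" for j by (simp add: M_def)
  have "strict_mono M" by (rule strict_monoI_Suc) (simp add: M_Suc N)
  have disj: "i = j" if "M i \<le> n" "n < M (Suc i)" "M j \<le> n" "n < M (Suc j)" for i j n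
  proof -
    have "M i < M (Suc j)" "M j < M (Suc i)" using that by auto
    then show ?thesis using \<open>strict_mono M\<close> by (simp add: strict_mono_less)
  qed
  define d :: "nat set \<Rightarrow> nat \<Rightarrow> complex"
    where "d A n = (if \<exists>j\<in>A. n \<in> block (M j) (M (Suc j)) then 1 else 0)" for A n
  have d1: "cmod (d A n) \<le> 1" for A n by (simp add: d_def)
  define g where "g A = comp_op \<phi> (lacunary (d A))" for A
  have g: "g A \<in> M0_space \<mu> p" for A
    unfolding g_def using T lacunary_Bloch[of "d A", OF d1] by blast
  have V: "normed_fun_space (M0_space \<mu> p) (M_norm \<mu> p)" by (rule normed_fun_space_M0[OF \<mu> p ax])
  interpret Metric_space "M0_space \<mu> p" "fun_dist (M0_space \<mu> p) (M_norm \<mu> p)"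
    by (rule Metric_space_fun_dist[OF V])
  \<comment> \<open>The value results from solving \<open>\<epsilon> < (400 * x) powr p\<close> for
    the norm \<open>x\<close> of a difference.\<close>
  define \<eta> where "\<eta> = \<epsilon> powr (1 / p) / 400"
  have \<eta>: "0 < \<eta>" using \<epsilon> by (simp add: \<eta>_def)
  have dist: "\<eta> \<le> fun_dist (M0_space \<mu> p) (M_norm \<mu> p) (g A) (g B)" if "A \<noteq> B" for A B
  proof -
    define D where "D n = d A n - d B n" for n
    \<comment> \<open>For \<open>j\<close> in the symmetric difference, the automorphism
      \<open>s (M j)\<close> sees mass greater than \<open>\<epsilon>\<close> on block
      \<open>j\<close>.\<close>
    obtain j where j: "j \<in> A \<longleftrightarrow> j \<notin> B" using \<open>A \<noteq> B\<close> by blast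
    have D1: "cmod (D n) \<le> 1" for n by (simp add: D_def d_def)
    have gap: "D n = 0" if "even n \<noteq> \<pi>" for n using that by (simp add: D_def d_def block_def)
    \<comment> \<open>The blocks are disjoint, so on block \<open>j\<close> exactly one of the two
      series has coefficient 1.\<close>
    have DA: "cmod (D m) = 1" if "m \<in> block (M j) (M (Suc j))" for m
    proof -
      have "d C m = (if j \<in> C then 1 else 0)" for C
        using that disj[of _ m j] by (auto simp: d_def block_def)
      then show ?thesis using j by (auto simp: D_def)
    qed
    have "lacunary D w = lacunary (d A) w - lacunary (d B) w" for w
    proof (cases "w \<in> disk")
      case True
      have "(\<lambda>n. D n * w ^ 100 ^ n) sums (lacunary (d A) w - lacunary (d B) w)"
        unfolding D_def left_diff_distrib
        by (intro sums_diff lacunary_sums(1) d1 True)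
      then show ?thesis
        using lacunary_sums(1)[of D, OF D1 True] sums_unique2 by blast
    qed (simp add: lacunary_def)
    then have eq: "(\<lambda>z. g A z - g B z) = comp_op \<phi> (lacunary D)"
      by (auto simp: g_def comp_op_def)
    have MD: "comp_op \<phi> (lacunary D) \<in> M_space \<mu> p"
      using T lacunary_Bloch[of D, OF D1] by (auto simp: M0_space_def)
    define x where "x = M_norm \<mu> p (comp_op \<phi> (lacunary D))"
    have x0: "0 \<le> x" by (simp add: x_def M_norm_nonneg)
    let ?\<sigma> = "s (M j)"
    have \<psi>: "self_map (\<phi> \<circ> ?\<sigma>)" by (rule self_map_comp_Aut[OF \<phi> s])
    have "ennreal \<epsilon> < emeasure (hyp_measure \<mu> p (\<phi> \<circ> ?\<sigma>)) (\<Union>m\<in>block (M j) (M (Suc j)). annulus m)"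
      using big by (simp add: M_Suc)
    also have "\<dots> \<le> ennreal (400 powr p) * deriv_integral \<mu> p (lacunary D \<circ> (\<phi> \<circ> ?\<sigma>))"
      by (rule hyp_measure_le_lacunary[of \<mu> _ p D \<pi>, OF \<mu> \<psi> p D1 gap DA])
    also have "\<dots> \<le> ennreal (400 powr p) * M_fun \<mu> p ?\<sigma> (comp_op \<phi> (lacunary D))"
      unfolding M_fun_def deriv_integral_comp_op[OF \<mu> s] by (intro mult_left_mono) auto
    also have "\<dots> \<le> ennreal (400 powr p) * ennreal (x powr p)"
      by (intro mult_left_mono M_fun_le_M_norm[OF p MD s]) (auto simp: x_def)
    also have "\<dots> = ennreal ((400 * x) powr p)"
      using x0 by (simp add: powr_mult flip: ennreal_mult)
    finally have "\<epsilon> < (400 * x) powr p" by (simp add: ennreal_less_iff \<epsilon> less_imp_le)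
    then have "\<epsilon> powr (1 / p) \<le> ((400 * x) powr p) powr (1 / p)"
      using \<epsilon> p by (intro powr_mono2) auto
    also have "\<dots> = 400 * x" using x0 p by (simp add: powr_powr)
    finally show ?thesis
      by (simp add: fun_dist_def g eq \<eta>_def x_def)
  qed
  have "countable (UNIV :: nat set set)"
    by (rule separable_imp_countable_separated[OF sep \<eta> g dist]) auto
  then show False using uncountable_nat_sets by contradiction
qed

text \<open>Each parity takes half of \<open>\<epsilon>\<close>, and beyond the larger threshold
  every point lies in one of the two tails. That \<open>R\<close> serves all automorphisms at once
  is what compactness rests on.\<close>

lemma hyp_measure_tail_small:
  assumes sep: "separable_space (norm_topology (M0_space \<mu> p) (M_norm \<mu> p))"
    and T: "comp_op \<phi> ` Bloch \<subseteq> M0_space \<mu> p" and \<epsilon>: "0 < \<epsilon>"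
  obtains R where "R < 1"
    "\<And>\<sigma>. \<sigma> \<in> Aut_disk \<Longrightarrow> emeasure (hyp_measure \<mu> p (\<phi> \<circ> \<sigma>)) {w \<in> disk. R < cmod w} \<le> ennreal \<epsilon>"
proof -
  let ?U = "\<lambda>M \<pi>. \<Union>m\<in>{m. M \<le> m \<and> even m = \<pi>}. annulus m"
  obtain M where M: "\<And>\<pi> \<sigma>. \<sigma> \<in> Aut_disk \<Longrightarrow>
      emeasure (hyp_measure \<mu> p (\<phi> \<circ> \<sigma>)) (?U (M \<pi>) \<pi>) \<le> ennreal (\<epsilon> / 2)"
    using hyp_measure_parity_tail_small[OF sep T, of "\<epsilon> / 2"] \<epsilon> by (metis half_gt_zero)
  define K where "K = max (M True) (M False)"
  have "emeasure (hyp_measure \<mu> p (\<phi> \<circ> \<sigma>)) {w \<in> disk. 1 - 1 / 100 ^ K < cmod w} \<le> ennreal \<epsilon>"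
    if \<sigma>: "\<sigma> \<in> Aut_disk" for \<sigma>
  proof -
    let ?\<nu> = "hyp_measure \<mu> p (\<phi> \<circ> \<sigma>)"
    have "{w \<in> disk. 1 - 1 / 100 ^ K < cmod w} \<subseteq> ?U (M True) True \<union> ?U (M False) False"
    proof
      fix w assume "w \<in> {w \<in> disk. 1 - 1 / 100 ^ K < cmod w}"
      then obtain m where "K \<le> m" "w \<in> annulus m" using ex_annulus[of w K] by auto
      then show "w \<in> ?U (M True) True \<union> ?U (M False) False"
        by (cases "even m") (auto simp: K_def)
    qed
    then have "emeasure ?\<nu> {w \<in> disk. 1 - 1 / 100 ^ K < cmod w}
        \<le> emeasure ?\<nu> (?U (M True) True \<union> ?U (M False) False)"
      using UN_annulus_borel by (intro emeasure_mono) auto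
    also have "\<dots> \<le> emeasure ?\<nu> (?U (M True) True) + emeasure ?\<nu> (?U (M False) False)"
      using UN_annulus_borel by (intro emeasure_subadditive) auto
    also have "\<dots> \<le> ennreal (\<epsilon> / 2) + ennreal (\<epsilon> / 2)" by (intro add_mono M \<sigma>)
    also have "\<dots> = ennreal \<epsilon>" using \<epsilon> by (simp flip: ennreal_plus)
    finally show ?thesis .
  qed
  then show ?thesis by (intro that[of "1 - 1 / 100 ^ K"]) auto
qed

section \<open>Compactness of the composition operator\<close>

text \<open>The image of the unit ball is itself sequentially compact. For a normal subsequence,
  derivatives converge uniformly on \<open>cball 0 R\<close>, and the rest of the disk carries
  little hyperbolic mass for every automorphism.\<close>

lemma comp_op_compact:
  assumes sep: "separable_space (norm_topology (M0_space \<mu> p) (M_norm \<mu> p))"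
    and T: "comp_op \<phi> ` Bloch \<subseteq> M0_space \<mu> p"
    and sup: "(SUP \<sigma>\<in>Aut_disk. hyp_integral \<mu> p (\<phi> \<circ> \<sigma>)) < \<infinity>"
  shows "compact_operator Bloch Bloch_norm (M0_space \<mu> p) (M_norm \<mu> p) (comp_op \<phi>)"
proof -
  have V: "normed_fun_space (M0_space \<mu> p) (M_norm \<mu> p)" by (rule normed_fun_space_M0[OF \<mu> p ax])
  interpret Metric_space "M0_space \<mu> p" "fun_dist (M0_space \<mu> p) (M_norm \<mu> p)"
    by (rule Metric_space_fun_dist[OF V])
  define S where "S = enn2real (SUP \<sigma>\<in>Aut_disk. hyp_integral \<mu> p (\<phi> \<circ> \<sigma>))"
  have S0: "0 \<le> S" by (simp add: S_def)
  have S: "hyp_integral \<mu> p (\<phi> \<circ> \<sigma>) \<le> ennreal S" if "\<sigma> \<in> Aut_disk" for \<sigma>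
    unfolding S_def using sup that by (auto intro: SUP_upper)
  let ?X = "comp_op \<phi> ` {f \<in> Bloch. Bloch_norm f \<le> 1}"
  have "compactin mtopology ?X"
    unfolding compactin_sequentially
  proof (intro conjI allI impI)
    show "?X \<subseteq> M0_space \<mu> p" using T by blast
    fix h :: "nat \<Rightarrow> complex \<Rightarrow> complex" assume "range h \<subseteq> ?X"
    then have "\<forall>n. \<exists>f. f \<in> Bloch \<and> Bloch_norm f \<le> 1 \<and> h n = comp_op \<phi> f" by blast
    then obtain f where f: "\<And>n. f n \<in> Bloch" "\<And>n. Bloch_norm (f n) \<le> 1" and h: "\<And>n. h n = comp_op \<phi> (f n)"
      by metis
    obtain g r where g: "g \<in> Bloch" "Bloch_norm g \<le> 1" and r: "strict_mono r"
      and pt: "\<And>z. z \<in> disk \<Longrightarrow> (\<lambda>n. f (r n) z) \<longlonglongrightarrow> g z"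
      and dl: "\<And>R \<epsilon>. R < 1 \<Longrightarrow> 0 < \<epsilon> \<Longrightarrow>
        \<forall>\<^sub>F n in sequentially. \<forall>w\<in>cball 0 R. cmod (deriv (f (r n)) w - deriv g w) \<le> \<epsilon>"
      by (rule Bloch_ball_normal[of f, OF f]) (rule that)
    have "\<forall>\<^sub>F n in sequentially. fun_dist (M0_space \<mu> p) (M_norm \<mu> p) (h (r n)) (comp_op \<phi> g) < e"
      if e: "0 < e" for e :: real
    proof -
      \<comment> \<open>One third each for the value at 0, for \<open>cball 0 R\<close> and for the
        tail; \<open>e / 2\<close> leaves room for a strict inequality.\<close>
      define a where "a = (e / 2) powr p / 3"
      have a: "0 < a" using e by (simp add: a_def)
      obtain R where R: "R < 1" and tail: "\<And>\<sigma>. \<sigma> \<in> Aut_disk \<Longrightarrow>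
          emeasure (hyp_measure \<mu> p (\<phi> \<circ> \<sigma>)) {w \<in> disk. R < cmod w} \<le> ennreal (a / 2 powr p)"
        \<comment> \<open>The tail mass is divided by \<open>2 powr p\<close> because the difference
          of two elements of the unit ball has Bloch weight at most 2.\<close>
        using hyp_measure_tail_small[OF sep T, of "a / 2 powr p"] a by auto
      \<comment> \<open>Chosen so that \<open>b powr p * S <= a\<close>; the \<open>S + 1\<close>
        avoids division by 0.\<close>
      define b where "b = (a / (S + 1)) powr (1 / p)"
      have b: "0 < b" using a S0 by (simp add: b_def)
      have bp: "b powr p = a / (S + 1)" using a S0 p by (simp add: b_def powr_powr)
      have "b powr p * S \<le> a" using a S0 by (simp add: bp field_simps)
      have "\<phi> 0 \<in> disk" using \<phi> by (force simp: self_map_def)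
      then have "(\<lambda>n. f (r n) (\<phi> 0) - g (\<phi> 0)) \<longlonglongrightarrow> 0"
        using pt LIM_zero by blast
      then have "\<forall>\<^sub>F n in sequentially. cmod (f (r n) (\<phi> 0) - g (\<phi> 0)) < a powr (1 / p)"
        using a by (auto dest!: tendstoD[of _ _ _ "a powr (1 / p)"])
      then show ?thesis
        using dl[OF R b]
      proof eventually_elim
        case (elim n)
        define k where "k z = f (r n) z - g z" for z
        have eq: "(\<lambda>z. h (r n) z - comp_op \<phi> g z) = comp_op \<phi> k"
          by (auto simp: h comp_op_def k_def)
        have M0: "h (r n) \<in> M0_space \<mu> p" "comp_op \<phi> g \<in> M0_space \<mu> p"
          using T f g by (auto simp: h)
        then have kM: "comp_op \<phi> k \<in> M_space \<mu> p"
          using normed_fun_space_diff[OF V] by (auto simp: eq[symmetric] M0_space_def)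
        have hol: "f (r n) holomorphic_on disk" "g holomorphic_on disk"
          using f g by (auto simp: Bloch_def H_disk_def)
        then have kh: "k holomorphic_on disk"
          unfolding k_def by (intro holomorphic_intros)
        have dk: "deriv k w = deriv (f (r n)) w - deriv g w" if "w \<in> disk" for w
          unfolding k_def using that
          by (intro deriv_diff holomorphic_on_imp_differentiable_at[OF hol(1) open_ball]
              holomorphic_on_imp_differentiable_at[OF hol(2) open_ball])
        let ?U = "{w \<in> disk. R < cmod w}"
        have "M_fun \<mu> p \<sigma> (comp_op \<phi> k) \<le> ennreal ((e / 2) powr p)" if \<sigma>: "\<sigma> \<in> Aut_disk" for \<sigma>
        proof -
          have "deriv_integral \<mu> p (k \<circ> (\<phi> \<circ> \<sigma>))
              \<le> ennreal (b powr p) * hyp_integral \<mu> p (\<phi> \<circ> \<sigma>)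
                + ennreal (2 powr p) * emeasure (hyp_measure \<mu> p (\<phi> \<circ> \<sigma>)) ?U"
          proof (rule deriv_integral_comp_le[OF \<mu> self_map_comp_Aut[OF \<phi> \<sigma>] kh p])
            have "?U = disk - cball 0 R" by auto
            then show "?U \<in> sets borel" by simp
          next
            fix w assume w: "w \<in> disk" "w \<notin> ?U"
            then have "cmod (deriv k w) \<le> b" using elim(2) dk by auto
            moreover have "(1 - (cmod w)\<^sup>2) * cmod (deriv k w) \<le> 1 * cmod (deriv k w)"
              by (intro mult_right_mono) auto
            ultimately show "(1 - (cmod w)\<^sup>2) * cmod (deriv k w) \<le> b" by simp
          next
            fix w assume w: "w \<in> disk" "w \<in> ?U"
            have "0 \<le> 1 - (cmod w)\<^sup>2" using w(1) by (simp add: power_le_one)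
            then have "(1 - (cmod w)\<^sup>2) * cmod (deriv k w)
                \<le> (1 - (cmod w)\<^sup>2) * (cmod (deriv (f (r n)) w) + cmod (deriv g w))"
              unfolding dk[OF w(1)] by (intro mult_left_mono norm_triangle_ineq4)
            moreover have "(1 - (cmod w)\<^sup>2) * cmod (deriv (f (r n)) w) \<le> 1"
              using Bloch_le_norm[OF f(1) w(1), of "r n"] f(2)[of "r n"] norm_ge_zero[of "f (r n) 0"] by linarith
            moreover have "(1 - (cmod w)\<^sup>2) * cmod (deriv g w) \<le> 1"
              using Bloch_le_norm[OF g(1) w(1)] g(2) norm_ge_zero[of "g 0"] by linarith
            ultimately show "(1 - (cmod w)\<^sup>2) * cmod (deriv k w) \<le> 2"
              unfolding distrib_left by linarith
          qed
          also have "\<dots> \<le> ennreal (b powr p) * ennreal S + ennreal (2 powr p) * ennreal (a / 2 powr p)"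
            by (intro add_mono mult_left_mono S tail \<sigma>) auto
          also have "\<dots> = ennreal (b powr p * S + a)"
            using S0 a by (simp flip: ennreal_mult ennreal_plus)
          also have "\<dots> \<le> ennreal (a + a)"
            using \<open>b powr p * S \<le> a\<close> by (intro ennreal_leI) simp
          finally have "deriv_integral \<mu> p (k \<circ> (\<phi> \<circ> \<sigma>)) \<le> ennreal (a + a)" .
          moreover have "cmod (comp_op \<phi> k 0) powr p \<le> a"
          proof -
            have "cmod (comp_op \<phi> k 0) \<le> a powr (1 / p)"
              using elim(1) by (simp add: comp_op_def k_def)
            then have "cmod (comp_op \<phi> k 0) powr p \<le> (a powr (1 / p)) powr p"
              using p by (intro powr_mono2) auto
            then show ?thesis using a p by (simp add: powr_powr)
          qed
          ultimately have "M_fun \<mu> p \<sigma> (comp_op \<phi> k) \<le> ennreal a + ennreal (a + a)"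
            unfolding M_fun_def deriv_integral_comp_op[OF \<mu> \<sigma>] by (intro add_mono ennreal_leI)
          also have "\<dots> = ennreal ((e / 2) powr p)"
            using a by (simp add: a_def flip: ennreal_plus)
          finally show ?thesis .
        qed
        \<comment> \<open>The index \<open>n\<close> was fixed before \<open>\<sigma>\<close>, so
          the estimates combine to a bound on the norm.\<close>
        then have "M_norm \<mu> p (comp_op \<phi> k) \<le> e / 2"
          using M_norm_le_iff[OF p kM, of "e / 2"] e by auto
        then show ?case using M0 e by (simp add: fun_dist_def eq)
      qed
    qed
    moreover have "comp_op \<phi> g \<in> M0_space \<mu> p" "h (r n) \<in> M0_space \<mu> p" for n
      using T f g by (auto simp: h)
    ultimately have "limitin mtopology (h \<circ> r) (comp_op \<phi> g) sequentially"
      unfolding limitin_metric by (auto simp: eventually_conj_iff)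
    moreover have "comp_op \<phi> g \<in> ?X" using g by blast
    ultimately show "\<exists>l r. l \<in> ?X \<and> strict_mono r \<and> limitin mtopology (h \<circ> r) l sequentially"
      using r by blast
  qed
  \<comment> \<open>Metric spaces are Hausdorff, so the compact image is closed and equals its
    closure.\<close>
  moreover from this have "mtopology closure_of ?X = ?X"
    using compactin_imp_closedin[OF Hausdorff_space_mtopology] closure_of_closedin by blast
  ultimately show ?thesis
    using comp_op_linear[OF T] by (simp add: compact_operator_def)
qed

end

section \<open>The equivalence of the three statements\<close>

theorem theorem4:
  fixes p :: real and \<mu> :: "complex measure" and \<phi> :: "complex \<Rightarrow> complex"
  assumes "1 \<le> p"
    and "sets \<mu> = sets (restrict_space borel disk)"
    and "standing_axiom \<mu> p"
    and "separable_space (norm_topology (M0_space \<mu> p) (M_norm \<mu> p))"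
    and "self_map \<phi>"
  shows "(bounded_operator Bloch Bloch_norm (M0_space \<mu> p) (M_norm \<mu> p) (comp_op \<phi>) \<longleftrightarrow>
          compact_operator Bloch Bloch_norm (M0_space \<mu> p) (M_norm \<mu> p) (comp_op \<phi>)) \<and>
         (compact_operator Bloch Bloch_norm (M0_space \<mu> p) (M_norm \<mu> p) (comp_op \<phi>) \<longleftrightarrow>
          ((\<lambda>\<sigma>. hyp_integral \<mu> p (\<phi> \<circ> \<sigma>)) \<longlongrightarrow> 0) aut_boundary \<and>
          (SUP \<sigma>\<in>Aut_disk. hyp_integral \<mu> p (\<phi> \<circ> \<sigma>)) < \<infinity>)"
    (is "(?a \<longleftrightarrow> ?b) \<and> (?b \<longleftrightarrow> ?c)")
proof -
  \<comment> \<open>The implications run from \<open>?a\<close> to \<open>?c\<close> to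
    \<open>?b\<close> and back to \<open>?a\<close>; separability enters between \<open>?c\<close>
    and \<open>?b\<close>.\<close>
  note ctx = assms(1,2,3,5)
  have "?c" if ?a
    using that comp_op_M0_imp_hyp_conditions[OF ctx]
    by (simp add: bounded_operator_def linear_operator_def)
  moreover have "?b" if ?c
  proof (rule comp_op_compact[OF ctx assms(4)])
    show "comp_op \<phi> ` Bloch \<subseteq> M0_space \<mu> p"
      using that hyp_conditions_imp_comp_op_M0[OF ctx] by blast
  qed (use that in blast)
  moreover have "?a" if ?b
    using that by (rule compact_imp_bounded_operator[OF assms(2,1,3)])
  ultimately show ?thesis by blast
qed

end
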